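(* Let $k$ be a field, $V_9$ a $9$-dimensional $k$-vector space, $u\in\bigwedge^3V_9$ a stable element, and $\Phi\colon V_9^*\to V_9\otimes\mathcal O_{\mathbf{P}(V_9^* )}(1)$ the associated family of alternating matrices. Let $Y\subset\mathbf{P}(V_9^* )$ be the locus where $\operatorname{rank}\Phi\le6$ and $X\subset\mathbf{P}(V_9^* )$ the locus where $\operatorname{rank}\Phi\le4$. Then $Y$ is a cubic hypersurface whose singular locus is $X$.
   Context: $\mathbf{P}(V_9^* )$ is the space of lines in $V_9^*$, so $V_9$ is its space of linear forms. An element $u$ is stable if, for the action of $\mathbf{SL}(V_9)/\boldsymbol{\mu}_3$ over an algebraic closure of $k$, its stabilizer is finite and its orbit is closed. Given $u$, apply the comultiplication $\bigwedge^3V_9\to\bigwedge^2V_9\otimes V_9$ and the surjection $V_9\otimes\mathcal O_{\mathbf{P}(V_9^* )}\to\mathcal O_{\mathbf{P}(V_9^* )}(1)$, and interpret $\bigwedge^2V_9$ as alternating (skew-symmetric) maps $V_9^*\to V_9$; this is $\Phi$ (at a point $x$, $\Phi(x)$ is the contraction of $u$ by $x$). Rank loci of $\Phi$ are defined by Pfaffians of the appropriate size ($8\times8$ for $Y$, $6\times6$ for $X$). *)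

theory Defs
  imports
    "HOL-Analysis.Determinants"
    "HOL-Algebra.Coset"
    "HOL-Algebra.Algebraic_Closure_Type"
    "HOL-Library.Poly_Mapping"
begin

unbundle no fps_syntax

type_synonym ('i, 'a) mpoly = "('i \<Rightarrow>\<^sub>0 nat) \<Rightarrow>\<^sub>0 'a"

definition Const :: "'a::zero \<Rightarrow> ('i, 'a) mpoly" where
  "Const c = Poly_Mapping.single 0 c"

definition Var :: "'i \<Rightarrow> ('i, 'a::zero_neq_one) mpoly" where
  "Var i = Poly_Mapping.single (Poly_Mapping.single i 1) 1"

definition eval :: "('i::finite \<Rightarrow> 'a::comm_semiring_1) \<Rightarrow> ('i, 'a) mpoly \<Rightarrow> 'a" where
  "eval a p = (\<Sum>m\<in>Poly_Mapping.keys p.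
     Poly_Mapping.lookup p m * (\<Prod>i\<in>UNIV. a i ^ Poly_Mapping.lookup m i))"

definition homogeneous :: "nat \<Rightarrow> ('i::finite, 'a::zero) mpoly \<Rightarrow> bool" where
  "homogeneous d p \<longleftrightarrow> (\<forall>m\<in>Poly_Mapping.keys p. (\<Sum>i\<in>UNIV. Poly_Mapping.lookup m i) = d)"

text \<open>The formal partial derivative; terms not involving the variable have coefficient 0 here,
  so the truncated subtraction of exponents does no harm.\<close>

definition pdiff :: "'i \<Rightarrow> ('i, 'a::comm_semiring_1) mpoly \<Rightarrow> ('i, 'a) mpoly" where
  "pdiff i p = (\<Sum>m\<in>Poly_Mapping.keys p.
     Poly_Mapping.single (m - Poly_Mapping.single i 1)
       (of_nat (Poly_Mapping.lookup m i) * Poly_Mapping.lookup p m))"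

definition poly_ac :: "('i, 'a::field) mpoly \<Rightarrow> ('i, 'a alg_closure) mpoly" where
  "poly_ac p = Poly_Mapping.map to_ac p"

definition zariski_closed :: "('i::finite \<Rightarrow> 'a::comm_semiring_1) set \<Rightarrow> bool" where
  "zariski_closed S \<longleftrightarrow> (\<exists>P :: ('i, 'a) mpoly set. S = {a. \<forall>p\<in>P. eval a p = 0})"

definition ideal_of :: "'a::comm_ring_1 set \<Rightarrow> 'a set" where
  "ideal_of P = module.span (*) P"

text \<open>
  For a homogeneous ideal \<open>I\<close> of \<open>K[x]\<close> and a point \<open>a \<noteq> 0\<close> of the affine cone, this is the set of
  homogeneous polynomials that become members of \<open>I\<close> after inverting the homogeneous polynomials
  not vanishing at \<open>a\<close>. The stalk at \<open>[a]\<close> of the associated ideal sheaf on projective space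
  consists of the fractions \<open>p / s\<close> with \<open>p\<close> in this set, \<open>s\<close> homogeneous of the same degree as \<open>p\<close>,
  and \<open>s\<close> not vanishing at \<open>a\<close>.
\<close>

definition ideal_stalk ::
    "('i::finite, 'a::comm_ring_1) mpoly set \<Rightarrow> ('i \<Rightarrow> 'a) \<Rightarrow> ('i, 'a) mpoly set" where
  "ideal_stalk I a = {p. (\<exists>d. homogeneous d p) \<and>
     (\<exists>g e. homogeneous e g \<and> eval a g \<noteq> 0 \<and> g * p \<in> I)}"

text \<open>
  Two sets of homogeneous equations over \<open>k\<close> cut out the same closed subscheme of projective space.
  By faithfully flat descent this can be tested after extending scalars to the algebraic closure
  of \<open>k\<close>, and there equality of ideal sheaves is equality of stalks at closed points.
\<close>

definition same_subscheme ::
    "('i::finite, 'k::field) mpoly set \<Rightarrow> ('i, 'k) mpoly set \<Rightarrow> bool" where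
  "same_subscheme P Q \<longleftrightarrow> (\<forall>a :: 'i \<Rightarrow> 'k alg_closure. a \<noteq> (\<lambda>_. 0) \<longrightarrow>
     ideal_stalk (ideal_of (poly_ac ` P)) a = ideal_stalk (ideal_of (poly_ac ` Q)) a)"

text \<open>
  The singular locus of the hypersurface \<open>F = 0\<close>, with its Jacobian scheme structure. The equation
  \<open>F\<close> is listed because it need not lie in the ideal of its partial derivatives when the
  characteristic divides its degree.
\<close>

definition singular_locus_eqs :: "('i, 'k::comm_semiring_1) mpoly \<Rightarrow> ('i, 'k) mpoly set" where
  "singular_locus_eqs F = insert F (Set.range (\<lambda>i. pdiff i F))"

text \<open>
  The Pfaffian of the submatrix of an alternating matrix \<open>A\<close> with rows and columns \<open>is\<close> (in this
  order, \<open>is\<close> of even length), by expansion along the first row.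
\<close>

fun pfaffian :: "('i \<Rightarrow> 'i \<Rightarrow> 'a::comm_ring_1) \<Rightarrow> 'i list \<Rightarrow> 'a" where
  "pfaffian A [] = 1"
| "pfaffian A (i # is) =
     (\<Sum>m<length is. (-1) ^ m * A i (is ! m) * pfaffian A (take m is @ drop (Suc m) is))"

text \<open>Reordering the indices changes a Pfaffian by a sign, so every index set may be listed in all
  possible orders without changing the ideal generated.\<close>

definition pfaffians :: "nat \<Rightarrow> ('i \<Rightarrow> 'i \<Rightarrow> 'a::comm_ring_1) \<Rightarrow> 'a set" where
  "pfaffians n A = {pfaffian A is | is. distinct is \<and> length is = n}"

text \<open>
  A basis \<open>e\<close> of \<open>V\<^sub>9\<close> is fixed, so \<open>V\<^sub>9 = k\<^sup>9\<close>. A trivector \<open>\<Sum>i<j<l. c i j l e\<^sub>i \<and> e\<^sub>j \<and> e\<^sub>l\<close> is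
  represented by the alternating extension of its coefficients \<open>c\<close> to all triples of indices, i.e. by
  the alternating trilinear form on the dual space that it defines. This is an isomorphism onto the
  alternating arrays in every characteristic.
\<close>

type_synonym 'a tensor3 = "9 \<times> 9 \<times> 9 \<Rightarrow> 'a"

definition trivector :: "'a::ab_group_add tensor3 \<Rightarrow> bool" where
  "trivector u \<longleftrightarrow>
     (\<forall>i j l. u (j, i, l) = - u (i, j, l) \<and> u (i, l, j) = - u (i, j, l)) \<and>
     (\<forall>i l. u (i, i, l) = 0 \<and> u (i, l, l) = 0)"

definition act :: "'a::comm_ring_1 ^ 9 ^ 9 \<Rightarrow> 'a tensor3 \<Rightarrow> 'a tensor3" where
  "act g u = (\<lambda>(i, j, l). \<Sum>p\<in>UNIV. \<Sum>q\<in>UNIV. \<Sum>r\<in>UNIV.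
     g $ i $ p * g $ j $ q * g $ l $ r * u (p, q, r))"

definition SL9 :: "('a::comm_ring_1 ^ 9 ^ 9) monoid" where
  "SL9 = \<lparr>carrier = {g. det g = 1}, monoid.mult = (**), one = mat 1\<rparr>"

definition mu3 :: "('a::comm_ring_1 ^ 9 ^ 9) set" where
  "mu3 = {mat z | z. z ^ 3 = 1}"

text \<open>
  Over an algebraically closed field the points of the quotient of the special linear group by
  \<open>\<mu>\<^sub>3\<close> are the cosets of \<open>mu3\<close>, in every characteristic. Scalars in \<open>mu3\<close> act trivially on
  trivectors, so all members of a coset act in the same way.
\<close>

definition stabilizer :: "'a::comm_ring_1 tensor3 \<Rightarrow> ('a ^ 9 ^ 9) set set" where
  "stabilizer u = {C \<in> carrier (SL9 Mod mu3). \<forall>g\<in>C. act g u = u}"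

definition SL9_orbit :: "'a::comm_ring_1 tensor3 \<Rightarrow> 'a tensor3 set" where
  "SL9_orbit u = {act g u | g. \<exists>C \<in> carrier (SL9 Mod mu3). g \<in> C}"

text \<open>Alternating arrays form a linear, hence Zariski closed, subspace of all arrays. So closedness of
  an orbit in the space of trivectors is the same as closedness in the space of all arrays.\<close>

definition stable_trivector :: "'k::field tensor3 \<Rightarrow> bool" where
  "stable_trivector u \<longleftrightarrow> (let v = (\<lambda>t. to_ac (u t)) in
     finite (stabilizer v) \<and> zariski_closed (SL9_orbit v))"

text \<open>
  The matrix of linear forms whose value at a point \<open>x\<close> of the dual space is the contraction of \<open>u\<close>
  by \<open>x\<close>. The coordinates of \<open>x\<close> are the basis vectors of \<open>V\<^sub>9\<close>, viewed as linear forms on the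
  dual space. They are the variables of the homogeneous coordinate ring.
\<close>

definition Phi :: "'k::comm_ring_1 tensor3 \<Rightarrow> 9 \<Rightarrow> 9 \<Rightarrow> (9, 'k) mpoly" where
  "Phi u i j = (\<Sum>l\<in>UNIV. Const (u (i, j, l)) * Var l)"

text \<open>An alternating matrix over a field has rank at most \<open>2r\<close> if and only if its sub-Pfaffians of
  size \<open>2r + 2\<close> vanish; these define the scheme structure of the rank locus.\<close>

definition rank_locus_eqs :: "nat \<Rightarrow> 'k::comm_ring_1 tensor3 \<Rightarrow> (9, 'k) mpoly set" where
  "rank_locus_eqs r u = pfaffians (2 * r + 2) (Phi u)"

end

(*
  Let A be the alternating matrix Phi u. Since A x = 0, the 8 x 8 Pfaffian omitting the index i is,
  up to sign, x_i F for a cubic form F, and F cuts out Y. Differentiating x_i F expresses the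
  partial derivatives of F through the 6 x 6 Pfaffians, which gives one inclusion between the ideal
  of X and the Jacobian ideal. For the other one, let a be a point and suppose that the 6 x 6
  Pfaffians are not in the localized Jacobian ideal. By Nakayama's lemma the relations that hold
  between them modulo this ideal have a common nonzero solution at a. It amounts to a nonzero
  bivector w with support in a complement of a in ker A(a), such that u(w, y) = 0 for all y.
  In a basis adapted to a and w, some one-parameter subgroup has nonnegative weights on u, so u is
  not stable. The same argument with smaller Pfaffians shows F is not 0: otherwise all Pfaffians,
  down to the empty one, would vanish.
*)
theory Submission
  imports Defs
begin

section \<open>Polynomials\<close>

text \<open>The singular locus is compared with \<open>X\<close> as a scheme and in every
  characteristic. So neither Euler's relation nor division by 2 is available: sums run over pairs
  \<open>p < q\<close>, vanishing on repeated arguments is proved beside antisymmetry, and ideals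
  are compared at one point \<open>a\<close> of the cone at a time. Pfaffians are indexed by the
  list of deleted indices, of which they are alternating functions. Three identities link
  \<open>m + 2\<close> deletions to \<open>m\<close>: contraction with a row of the matrix turns the
  former Pfaffians into the latter; the wedge of the former with the vector of variables is zero;
  the derivatives of the latter are contractions of \<open>u\<close> with the former. Once the
  Pfaffians with \<open>m\<close> deletions and their derivatives lie in an ideal, these are linear
  relations modulo it, and a functional on the fibre at \<open>a\<close> satisfies their values at
  \<open>a\<close>. This step is stated for any ideal saturated at \<open>a\<close>, because it is
  used for the zero ideal and for the saturated Jacobian ideal.\<close>

lemma poly_mapping_induct [case_names single add]:
  fixes p :: "'a \<Rightarrow>\<^sub>0 'b::comm_monoid_add"
  assumes "\<And>m c. P (Poly_Mapping.single m c)" and "\<And>p q. P p \<Longrightarrow> P q \<Longrightarrow> P (p + q)"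
  shows "P p"
proof (induction p rule: update_induct)
  case const
  then show ?case using assms(1)[of _ 0] by simp
next
  case (update p m c)
  have "Poly_Mapping.update m c p = p + Poly_Mapping.single m c"
    using update(1) by (intro poly_mapping_eqI) (auto simp: lookup_update lookup_add lookup_single in_keys_iff when_def)
  then show ?case using assms update by simp
qed

lemma eval_add: "eval a (p + q) = eval a p + eval a q"
  unfolding eval_def by (rule setsum_keys_plus_distrib) (auto simp: algebra_simps)

lemma eval_single: "eval a (Poly_Mapping.single m c) = c * (\<Prod>i\<in>UNIV. a i ^ Poly_Mapping.lookup m i)"
  by (simp add: eval_def)

lemma eval_0 [simp]: "eval a 0 = 0"
  by (simp add: eval_def)

lemma eval_Const [simp]: "eval a (Const c) = c"
  by (simp add: Const_def eval_single)

lemma eval_1 [simp]: "eval a 1 = 1"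
  using eval_Const[of a 1] by (simp add: Const_def)

lemma eval_Var [simp]: "eval a (Var i) = a i"
proof -
  have "(\<Prod>j\<in>UNIV. a j ^ Poly_Mapping.lookup (Poly_Mapping.single i 1) j) = (\<Prod>j\<in>UNIV. if j = i then a j else 1)"
    by (intro prod.cong) (auto simp: lookup_single when_def)
  then show ?thesis by (simp add: Var_def eval_single)
qed

lemma eval_mult: "eval a (p * q) = eval a p * eval a q"
proof (induction p rule: poly_mapping_induct)
  case (single m c)
  show ?case
    by (induction q rule: poly_mapping_induct)
      (simp_all add: eval_add eval_single mult_single lookup_add power_add prod.distrib algebra_simps)
qed (simp add: eval_add algebra_simps)

lemma eval_sum: "eval a (\<Sum>i\<in>I. f i) = (\<Sum>i\<in>I. eval a (f i))"
  by (induction I rule: infinite_finite_induct) (simp_all add: eval_add)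

lemma eval_prod: "eval a (\<Prod>i\<in>I. f i) = (\<Prod>i\<in>I. eval a (f i))"
  by (induction I rule: infinite_finite_induct) (simp_all add: eval_mult)

lemma eval_uminus: "eval a (- p) = - eval a (p :: ('i::finite, 'a::comm_ring_1) mpoly)"
  using eval_add[of a p "- p"] by (simp add: eq_neg_iff_add_eq_0 add.commute)

lemma eval_diff: "eval a (p - q) = eval a p - eval a (q :: ('i::finite, 'a::comm_ring_1) mpoly)"
  using eval_add[of a p "- q"] by (simp add: eval_uminus)

lemma pdiff_add: "pdiff i (p + q) = pdiff i p + pdiff i q"
  unfolding pdiff_def by (rule setsum_keys_plus_distrib) (auto simp: algebra_simps single_add)

lemma pdiff_single:
  "pdiff i (Poly_Mapping.single m c) =
     Poly_Mapping.single (m - Poly_Mapping.single i 1) (of_nat (Poly_Mapping.lookup m i) * c)"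
  by (simp add: pdiff_def)

lemma pdiff_0 [simp]: "pdiff i 0 = 0"
  by (simp add: pdiff_def)

lemma pdiff_Const [simp]: "pdiff i (Const c) = 0"
  by (simp add: Const_def pdiff_single)

lemma pdiff_Var: "pdiff i (Var j) = (if i = j then 1 else 0)"
  by (auto simp: Var_def pdiff_single lookup_single when_def)

lemma pdiff_mult_single:
  "pdiff i (Poly_Mapping.single m c * Poly_Mapping.single n d) =
     pdiff i (Poly_Mapping.single m c) * Poly_Mapping.single n d +
     Poly_Mapping.single m c * pdiff i (Poly_Mapping.single n d)"
proof -
  define e where "e = (Poly_Mapping.single i 1 :: 'a \<Rightarrow>\<^sub>0 nat)"
  \<comment> \<open>Subtraction of exponents is truncated, so the variable must occur in
    \<open>m\<close>. Where it does not occur, the coefficient is zero and the exponent does not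
    matter.\<close>
  have shift: "m + n - e = (m - e) + n" if "Poly_Mapping.lookup m i > 0" for m n
    using that by (intro poly_mapping_eqI) (auto simp: e_def lookup_add lookup_minus lookup_single when_def)
  have "Poly_Mapping.single (m + n - e) (of_nat (Poly_Mapping.lookup m i) * c * d) =
      Poly_Mapping.single (m - e + n) (of_nat (Poly_Mapping.lookup m i) * c * d)"
    using shift[of m n] by (cases "Poly_Mapping.lookup m i = 0") auto
  moreover have "Poly_Mapping.single (m + n - e) (c * (of_nat (Poly_Mapping.lookup n i) * d)) =
      Poly_Mapping.single (m + (n - e)) (c * (of_nat (Poly_Mapping.lookup n i) * d))"
    using shift[of n m] by (cases "Poly_Mapping.lookup n i = 0") (auto simp: add.commute)
  ultimately show ?thesis
    unfolding mult_single pdiff_single lookup_add of_nat_add e_def[symmetric] distrib_right mult.assoc single_add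
      mult.left_commute[of c] by (simp only:)
qed

lemma pdiff_mult: "pdiff i (p * q) = pdiff i p * q + p * pdiff i q"
proof (induction p rule: poly_mapping_induct)
  case (single m c)
  show ?case
  proof (induction q rule: poly_mapping_induct)
    case (single n d)
    then show ?case by (rule pdiff_mult_single)
  qed (simp add: pdiff_add algebra_simps)
qed (simp add: pdiff_add algebra_simps)

lemma pdiff_sum: "pdiff i (\<Sum>j\<in>J. f j) = (\<Sum>j\<in>J. pdiff i (f j))"
  by (induction J rule: infinite_finite_induct) (simp_all add: pdiff_add)

lemma lookup_poly_ac: "Poly_Mapping.lookup (poly_ac p) m = to_ac (Poly_Mapping.lookup p m)"
  by (auto simp: poly_ac_def map.rep_eq when_def)

lemma poly_ac_single: "poly_ac (Poly_Mapping.single m c) = Poly_Mapping.single m (to_ac c)"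
  by (intro poly_mapping_eqI) (auto simp: lookup_poly_ac lookup_single when_def)

lemma poly_ac_add: "poly_ac (p + q) = poly_ac p + poly_ac q"
  by (intro poly_mapping_eqI) (auto simp: lookup_poly_ac lookup_add)

lemma poly_ac_0 [simp]: "poly_ac 0 = 0"
  by (intro poly_mapping_eqI) (auto simp: lookup_poly_ac)

lemma poly_ac_uminus: "poly_ac (- p) = - poly_ac p"
  by (intro poly_mapping_eqI) (auto simp: lookup_poly_ac)

lemma poly_ac_Const: "poly_ac (Const c) = Const (to_ac c)"
  by (simp add: Const_def poly_ac_single)

lemma poly_ac_1 [simp]: "poly_ac 1 = 1"
  using poly_ac_Const[of 1] by (simp add: Const_def)

lemma poly_ac_Var: "poly_ac (Var i) = Var i"
  by (simp add: Var_def poly_ac_single)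

lemma poly_ac_mult: "poly_ac (p * q) = poly_ac p * poly_ac q"
proof (induction p rule: poly_mapping_induct)
  case (single m c)
  show ?case
    by (induction q rule: poly_mapping_induct)
      (simp_all add: poly_ac_single mult_single poly_ac_add algebra_simps)
qed (simp add: poly_ac_add algebra_simps)

lemma poly_ac_sum: "poly_ac (\<Sum>j\<in>J. f j) = (\<Sum>j\<in>J. poly_ac (f j))"
  by (induction J rule: infinite_finite_induct) (simp_all add: poly_ac_add)

lemma poly_ac_pdiff: "poly_ac (pdiff i p) = pdiff i (poly_ac p)"
  by (induction p rule: poly_mapping_induct)
    (simp_all add: pdiff_single poly_ac_single poly_ac_add pdiff_add)

lemma homogeneous_0: "homogeneous d 0"
  by (simp add: homogeneous_def)

lemma homogeneous_1: "homogeneous 0 1"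
  by (simp add: homogeneous_def)

lemma homogeneous_Const: "homogeneous 0 (Const c)"
  by (simp add: homogeneous_def Const_def)

lemma homogeneous_Var: "homogeneous 1 (Var i)"
proof -
  have "(\<Sum>j\<in>UNIV. Poly_Mapping.lookup (Poly_Mapping.single i (1::nat)) j) = (\<Sum>j\<in>UNIV. if j = i then 1 else 0)"
    by (intro sum.cong) (auto simp: lookup_single when_def)
  then show ?thesis by (simp add: homogeneous_def Var_def)
qed

lemma homogeneous_add: "homogeneous d p \<Longrightarrow> homogeneous d q \<Longrightarrow> homogeneous d (p + q)"
  using keys_add[of p q] by (auto simp: homogeneous_def)

lemma homogeneous_uminus: "homogeneous d p \<Longrightarrow> homogeneous d (- p :: ('i::finite, 'a::comm_ring_1) mpoly)"
  by (auto simp: homogeneous_def in_keys_iff)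

lemma homogeneous_mult: "homogeneous d p \<Longrightarrow> homogeneous e q \<Longrightarrow> homogeneous (d + e) (p * q)"
  using keys_mult[of p q] by (fastforce simp: homogeneous_def lookup_add sum.distrib)

lemma homogeneous_sum: "(\<And>i. i \<in> I \<Longrightarrow> homogeneous d (f i)) \<Longrightarrow> homogeneous d (\<Sum>i\<in>I. f i)"
  by (induction I rule: infinite_finite_induct) (auto intro: homogeneous_add homogeneous_0)

lemma homogeneous_poly_ac: "homogeneous d p \<Longrightarrow> homogeneous d (poly_ac p)"
  by (auto simp: homogeneous_def in_keys_iff lookup_poly_ac)

lemma homogeneous_pdiff: "homogeneous (Suc d) p \<Longrightarrow> homogeneous d (pdiff i p)"
  unfolding pdiff_def
proof (rule homogeneous_sum)
  fix m assume p: "homogeneous (Suc d) p" and m: "m \<in> Poly_Mapping.keys p"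
  show "homogeneous d (Poly_Mapping.single (m - Poly_Mapping.single i 1) (of_nat (Poly_Mapping.lookup m i) * Poly_Mapping.lookup p m))"
  proof (cases "Poly_Mapping.lookup m i = 0")
    case False
    have "Poly_Mapping.lookup m j = Poly_Mapping.lookup (m - Poly_Mapping.single i 1) j + (if j = i then 1 else 0)" for j
      using False by (auto simp: lookup_minus lookup_single when_def)
    then have "(\<Sum>j\<in>UNIV. Poly_Mapping.lookup m j) =
        (\<Sum>j\<in>UNIV. Poly_Mapping.lookup (m - Poly_Mapping.single i 1) j + (if j = i then 1 else 0))"
      by (rule sum.cong[OF refl])
    then have "(\<Sum>j\<in>UNIV. Poly_Mapping.lookup (m - Poly_Mapping.single i 1) j) = d"
      using p m by (simp add: homogeneous_def sum.distrib)
    then show ?thesis by (simp add: homogeneous_def)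
  qed (simp add: homogeneous_0)
qed

section \<open>Homogeneous components, which turn arbitrary denominators into homogeneous
  ones\<close>

definition hom_comp :: "nat \<Rightarrow> ('i::finite, 'a::comm_monoid_add) mpoly \<Rightarrow> ('i, 'a) mpoly" where
  "hom_comp d p = (\<Sum>m\<in>Poly_Mapping.keys p. Poly_Mapping.single m
     (if (\<Sum>i\<in>UNIV. Poly_Mapping.lookup m i) = d then Poly_Mapping.lookup p m else 0))"

lemma hom_comp_add: "hom_comp d (p + q) = hom_comp d p + hom_comp d q"
  unfolding hom_comp_def by (rule setsum_keys_plus_distrib) (auto simp: single_add)

lemma hom_comp_single: "hom_comp d (Poly_Mapping.single m c) =
    (if (\<Sum>i\<in>UNIV. Poly_Mapping.lookup m i) = d then Poly_Mapping.single m c else 0)"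
  by (simp add: hom_comp_def)

lemma hom_comp_0 [simp]: "hom_comp d 0 = 0"
  by (simp add: hom_comp_def)

lemma homogeneous_hom_comp: "homogeneous d (hom_comp d p)"
  unfolding hom_comp_def by (rule homogeneous_sum) (auto simp: homogeneous_def)

lemma hom_comp_mult_homogeneous:
  assumes "homogeneous e q"
  shows "hom_comp (d + e) (p * q) = hom_comp d p * (q :: ('i::finite, 'a::comm_ring_1) mpoly)"
proof (induction p rule: poly_mapping_induct)
  case (single m c)
  have q: "q = (\<Sum>n\<in>Poly_Mapping.keys q. Poly_Mapping.single n (Poly_Mapping.lookup q n))"
    by (intro poly_mapping_eqI) (auto simp: lookup_sum lookup_single when_def in_keys_iff)
  have sum: "hom_comp k (\<Sum>i\<in>I. f i) = (\<Sum>i\<in>I. hom_comp k (f i))" for k I and f :: "('i \<Rightarrow>\<^sub>0 nat) \<Rightarrow> ('i, 'a) mpoly"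
    by (induction I rule: infinite_finite_induct) (auto simp: hom_comp_add)
  have "hom_comp (d + e) (Poly_Mapping.single m c * q) =
      hom_comp (d + e) (Poly_Mapping.single m c * (\<Sum>n\<in>Poly_Mapping.keys q. Poly_Mapping.single n (Poly_Mapping.lookup q n)))"
    by (simp flip: q)
  also have "\<dots> = (\<Sum>n\<in>Poly_Mapping.keys q. hom_comp d (Poly_Mapping.single m c) * Poly_Mapping.single n (Poly_Mapping.lookup q n))"
    unfolding sum_distrib_left sum using assms
    by (intro sum.cong) (auto simp: mult_single hom_comp_single homogeneous_def lookup_add sum.distrib)
  also have "\<dots> = hom_comp d (Poly_Mapping.single m c) * q"
    by (simp add: q[symmetric] flip: sum_distrib_left)
  finally show ?case .
qed (simp add: hom_comp_add algebra_simps)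

lemma hom_comp_mult_homogeneous_less:
  assumes "homogeneous e q" "d < e"
  shows "hom_comp d (p * q) = (0 :: ('i::finite, 'a::comm_ring_1) mpoly)"
proof -
  have "hom_comp d r = 0" if "\<And>m. m \<in> Poly_Mapping.keys r \<Longrightarrow> (\<Sum>i\<in>UNIV. Poly_Mapping.lookup m i) \<noteq> d" for r :: "('i, 'a) mpoly"
    unfolding hom_comp_def using that by (intro sum.neutral) auto
  then show ?thesis
    using assms keys_mult[of p q] by (fastforce simp: homogeneous_def lookup_add sum.distrib)
qed

lemma eval_hom_comp:
  fixes p :: "('i::finite, 'a::comm_ring_1) mpoly"
  assumes "eval a p \<noteq> 0"
  shows "\<exists>d. eval a (hom_comp d p) \<noteq> 0"
proof (rule ccontr)
  assume *: "\<not> ?thesis"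
  define D where "D = (\<lambda>m. \<Sum>i\<in>UNIV. Poly_Mapping.lookup m i) ` Poly_Mapping.keys p"
  have "p = (\<Sum>d\<in>D. hom_comp d p)"
  proof (intro poly_mapping_eqI)
    fix m
    have "Poly_Mapping.lookup (hom_comp d p) m =
      (if (\<Sum>i\<in>UNIV. Poly_Mapping.lookup m i) = d then Poly_Mapping.lookup p m else 0)" for d
      by (auto simp: hom_comp_def lookup_sum lookup_single when_def in_keys_iff)
    then show "Poly_Mapping.lookup p m = Poly_Mapping.lookup (\<Sum>d\<in>D. hom_comp d p) m"
      by (auto simp: lookup_sum D_def in_keys_iff)
  qed
  then have "eval a p = (\<Sum>d\<in>D. eval a (hom_comp d p))" by (metis eval_sum)
  then show False using * assms by simp
qed

section \<open>Pfaffians\<close>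

definition del :: "nat \<Rightarrow> 'a list \<Rightarrow> 'a list" where
  "del m xs = take m xs @ drop (Suc m) xs"

lemma length_del [simp]: "m < length xs \<Longrightarrow> length (del m xs) = length xs - 1"
  by (simp add: del_def)

lemma nth_del: "m < length xs \<Longrightarrow> i < length xs - 1 \<Longrightarrow> del m xs ! i = (if i < m then xs ! i else xs ! Suc i)"
  by (simp add: del_def nth_append min_def)

lemma map_del: "map f (del m xs) = del m (map f xs)"
  by (simp add: del_def take_map drop_map)

lemma del_append:
  "del m (us @ vs) = (if m < length us then del m us @ vs else us @ del (m - length us) vs)"
  by (simp add: del_def Suc_diff_le)

lemma del_del:
  assumes "m \<le> n" "Suc n < length xs"
  shows "del n (del m xs) = del m (del (Suc n) xs)"
  using assms by (intro nth_equalityI) (simp_all add: nth_del)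

lemma pfaffian_Cons: "pfaffian A (x # xs) = (\<Sum>m<length xs. (-1) ^ m * A x (xs ! m) * pfaffian A (del m xs))"
  by (simp add: del_def)

declare pfaffian.simps(2) [simp del]

lemma sum_lessThan_add: "(\<Sum>i<a + b. f i) = (\<Sum>i<a. f i) + (\<Sum>i<b. f (a + i))" for a b :: nat
  by (induction b) (simp_all add: add.assoc)

text \<open>Two distinct positions are chosen one after the other, the second counted in the list
  without the first. The sum is regrouped by unordered pairs, here the positions \<open>m\<close>
  and \<open>Suc n\<close>.\<close>

lemma sum_pairs:
  "(\<Sum>m<Suc N. \<Sum>n<N. g m n) = (\<Sum>n<N. \<Sum>m\<le>n. g m n + g (Suc n) m)"
  for g :: "nat \<Rightarrow> nat \<Rightarrow> 'a::comm_monoid_add"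
proof (induction N)
  case (Suc N)
  define S where "S = (\<Sum>n<N. \<Sum>m\<le>n. g m n + g (Suc n) m)"
  have "(\<Sum>m<Suc (Suc N). \<Sum>n<Suc N. g m n) = (\<Sum>m<Suc N. (\<Sum>n<N. g m n) + g m N) + (\<Sum>n<Suc N. g (Suc N) n)"
    by (simp only: sum.lessThan_Suc)
  also have "\<dots> = S + (\<Sum>m<Suc N. g m N) + (\<Sum>n<Suc N. g (Suc N) n)"
    unfolding sum.distrib Suc S_def ..
  also have "\<dots> = S + (\<Sum>m\<le>N. g m N + g (Suc N) m)"
    unfolding sum.distrib lessThan_Suc_atMost by (rule add.assoc)
  finally show ?case by (simp only: S_def sum.lessThan_Suc[of _ N])
qed simp

lemma pfaffian_Cons_append:
  "pfaffian A (z # us @ vs) =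
     (\<Sum>m<length us. (-1) ^ m * A z (us ! m) * pfaffian A (del m us @ vs)) +
     (\<Sum>m<length vs. (-1) ^ (length us + m) * A z (vs ! m) * pfaffian A (us @ del m vs))"
  unfolding pfaffian_Cons length_append sum_lessThan_add
  by (intro arg_cong2[where f = "(+)"] sum.cong) (simp_all add: nth_append del_append)

lemma pfaffian_hom:
  assumes add: "\<And>x y. h (x + y) = h x + h y" and mult: "\<And>x y. h (x * y) = h x * h y" and one: "h 1 = 1"
  shows "pfaffian (\<lambda>i j. h (A i j)) xs = h (pfaffian A xs)"
proof -
  have h0: "h 0 = 0" using add[of 0 0] by simp
  have hm: "h (- x) = - h x" for x using add[of x "- x"] h0 by (simp add: eq_neg_iff_add_eq_0 add.commute)
  have hp: "h ((-1) ^ m) = (-1) ^ m" for m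
    by (induction m) (auto simp: one mult hm)
  have hs: "h (\<Sum>i<n. f i) = (\<Sum>i<n. h (f i))" for f and n :: nat
    by (induction n) (auto simp: h0 add)
  show ?thesis
  proof (induction xs rule: length_induct)
    case (1 xs)
    then show ?case by (cases xs) (auto simp: pfaffian_Cons one hs mult hp intro!: sum.cong)
  qed
qed

lemma pfaffian_map: "pfaffian B (map h xs) = pfaffian (\<lambda>i j. B (h i) (h j)) xs"
proof (induction xs rule: length_induct)
  case (1 xs)
  show ?case
  proof (cases xs)
    case (Cons x ys)
    have "pfaffian B (del m (map h ys)) = pfaffian (\<lambda>i j. B (h i) (h j)) (del m ys)" if "m < length ys" for m
      using 1 that by (simp add: Cons flip: map_del)
    then show ?thesis by (simp add: Cons pfaffian_Cons)
  qed auto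
qed

definition alternating :: "('i \<Rightarrow> 'i \<Rightarrow> 'a::comm_ring_1) \<Rightarrow> bool" where
  "alternating A \<longleftrightarrow> (\<forall>i j. A j i = - A i j) \<and> (\<forall>i. A i i = 0)"

lemma alternatingD:
  assumes "alternating A"
  shows "A j i = - A i j" "A i i = 0"
  using assms unfolding alternating_def by blast+

text \<open>In the expansion along two rows every pair of columns is reached in both orders, with
  opposite signs, so \<open>x\<close> and \<open>y\<close> enter through \<open>A x y\<close> and
  the 2 x 2 minors of their rows. This makes the antisymmetry in the first two labels
  visible.\<close>

lemma pfaffian_Cons_Cons:
  "pfaffian A (x # y # zs) = A x y * pfaffian A zs -
     (\<Sum>n<length zs - 1. \<Sum>m\<le>n. (-1) ^ (m + n) * pfaffian A (del m (del (Suc n) zs)) *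
        (A x (zs ! m) * A y (zs ! Suc n) - A x (zs ! Suc n) * A y (zs ! m)))"
proof (cases "length zs")
  case 0
  then show ?thesis by (simp add: pfaffian_Cons del_def)
next
  case (Suc N)
  define g where "g m n = (-1) ^ (m + n) * (A x (zs ! m) * A y (del m zs ! n)) * pfaffian A (del n (del m zs))" for m n
  have "(\<Sum>m<length zs. (-1) ^ m * A x (zs ! m) * pfaffian A (y # del m zs)) = (\<Sum>m<Suc N. \<Sum>n<N. g m n)"
    unfolding Suc
  proof (rule sum.cong)
    fix m assume "m \<in> {..<Suc N}"
    then show "(-1) ^ m * A x (zs ! m) * pfaffian A (y # del m zs) = (\<Sum>n<N. g m n)"
      unfolding pfaffian_Cons sum_distrib_left g_def
      by (intro sum.cong) (auto simp: Suc power_add mult_ac)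
  qed simp
  also have "\<dots> = (\<Sum>n<N. \<Sum>m\<le>n. g m n + g (Suc n) m)" by (rule sum_pairs)
  also have "\<dots> = (\<Sum>n<N. \<Sum>m\<le>n. (-1) ^ (m + n) * pfaffian A (del m (del (Suc n) zs)) *
        (A x (zs ! m) * A y (zs ! Suc n) - A x (zs ! Suc n) * A y (zs ! m)))"
  proof (intro sum.cong refl)
    fix n m assume "n \<in> {..<N}" "m \<in> {..n}"
    then have mn: "m \<le> n" "Suc n < length zs" using Suc by auto
    have "del m zs ! n = zs ! Suc n" "del (Suc n) zs ! m = zs ! m"
      using mn nth_del[of m zs n] nth_del[of "Suc n" zs m] by auto
    then show "g m n + g (Suc n) m = (-1) ^ (m + n) * pfaffian A (del m (del (Suc n) zs)) *
        (A x (zs ! m) * A y (zs ! Suc n) - A x (zs ! Suc n) * A y (zs ! m))"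
      unfolding g_def del_del[OF mn] by (simp add: algebra_simps)
  qed
  finally have *: "(\<Sum>m<length zs. (-1) ^ m * A x (zs ! m) * pfaffian A (y # del m zs)) = \<dots>" .
  have "pfaffian A (x # [y] @ zs) = A x y * pfaffian A zs -
     (\<Sum>m<length zs. (-1) ^ m * A x (zs ! m) * pfaffian A (y # del m zs))"
    unfolding pfaffian_Cons_append by (simp add: sum_negf del_def)
  then show ?thesis unfolding * using Suc by simp
qed

text \<open>Induction on the length: at the front the two-row expansion applies, elsewhere the
  expansion along the first row leads to shorter lists. Vanishing on a repeated label is carried
  along, because in characteristic 2 it does not follow from the change of sign.\<close>

lemma pfaffian_swap_repeat:
  assumes A: "alternating A"
  shows "pfaffian A (xs @ x # y # ys) = - pfaffian A (xs @ y # x # ys)"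
    and "pfaffian A (xs @ x # x # ys) = 0"
proof -
  have "pfaffian A (xs @ x # y # ys) + pfaffian A (xs @ y # x # ys) = 0 \<and> pfaffian A (xs @ x # x # ys) = 0"
  proof (induction "length xs + length ys" arbitrary: xs ys rule: less_induct)
    case less
    show ?case
    proof (cases xs)
      case Nil
      define T where "T x y = (\<Sum>n<length ys - 1. \<Sum>m\<le>n. (-1) ^ (m + n) * pfaffian A (del m (del (Suc n) ys)) *
        (A x (ys ! m) * A y (ys ! Suc n) - A x (ys ! Suc n) * A y (ys ! m)))" for x y
      have "T x y = - T y x"
        unfolding T_def by (simp only: sum_negf[symmetric], intro sum.cong refl) (simp add: right_diff_distrib mult.commute)
      moreover have "T x x = 0"
        unfolding T_def by (intro sum.neutral ballI) (simp add: mult.commute)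
      moreover note alternatingD(1)[OF A, of y x] alternatingD(2)[OF A, of x]
      ultimately show ?thesis
        unfolding Nil append_Nil pfaffian_Cons_Cons T_def[symmetric] by simp
    next
      case (Cons z us)
      have two: "(\<Sum>m<length (a # b # ys). f m) = f 0 + f 1 + (\<Sum>m<length ys. f (m + 2))" for a b :: 'a and f :: "nat \<Rightarrow> 'b"
        using sum_lessThan_add[of f 2 "length ys"] by (simp add: numeral_2_eq_2)
      have pf: "pfaffian A (z # us @ a # b # ys) =
          (\<Sum>m<length us. (-1) ^ m * A z (us ! m) * pfaffian A (del m us @ a # b # ys)) +
          ((-1) ^ length us * A z a * pfaffian A (us @ b # ys) - (-1) ^ length us * A z b * pfaffian A (us @ a # ys) +
          (\<Sum>m<length ys. (-1) ^ (length us + m) * A z (ys ! m) * pfaffian A (us @ a # b # del m ys)))" for a b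
        unfolding pfaffian_Cons_append two by (simp add: del_def)
      have IH1: "pfaffian A (del m us @ x # y # ys) + pfaffian A (del m us @ y # x # ys) = 0"
        "pfaffian A (del m us @ x # x # ys) = 0" if "m < length us" for m
        using that less[of "del m us" ys] Cons by auto
      have IH2: "pfaffian A (us @ x # y # del m ys) + pfaffian A (us @ y # x # del m ys) = 0"
        "pfaffian A (us @ x # x # del m ys) = 0" if "m < length ys" for m
        using that less[of us "del m ys"] Cons by auto
      have "pfaffian A (z # us @ x # x # ys) = 0"
        unfolding pf using IH1 IH2 by simp
      moreover have "pfaffian A (z # us @ x # y # ys) = - pfaffian A (z # us @ y # x # ys)"
      proof -
        have "pfaffian A (del m us @ x # y # ys) = - pfaffian A (del m us @ y # x # ys)" if "m < length us" for m
          using IH1(1)[OF that] by (simp add: eq_neg_iff_add_eq_0)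
        moreover have "pfaffian A (us @ x # y # del m ys) = - pfaffian A (us @ y # x # del m ys)" if "m < length ys" for m
          using IH2(1)[OF that] by (simp add: eq_neg_iff_add_eq_0)
        ultimately show ?thesis
          unfolding pf by (simp add: sum_negf)
      qed
      ultimately show ?thesis by (simp add: Cons)
    qed
  qed
  then show "pfaffian A (xs @ x # y # ys) = - pfaffian A (xs @ y # x # ys)"
    and "pfaffian A (xs @ x # x # ys) = 0" by (auto simp: eq_neg_iff_add_eq_0)
qed

lemma pfaffian_move:
  assumes "alternating A"
  shows "pfaffian A (zs @ us @ x # vs) = (-1) ^ length us * pfaffian A (zs @ x # us @ vs)"
proof (induction us arbitrary: zs)
  case (Cons u us)
  show ?case
    using Cons[of "zs @ [u]"] pfaffian_swap_repeat(1)[OF assms, of zs u x "us @ vs"] by simp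
qed simp

lemma pfaffian_perm:
  assumes A: "alternating A" and "mset xs = mset ys"
  shows "pfaffian A xs = pfaffian A ys \<or> pfaffian A xs = - pfaffian A ys"
proof -
  have "pfaffian A (zs @ xs) = pfaffian A (zs @ ys) \<or> pfaffian A (zs @ xs) = - pfaffian A (zs @ ys)" for zs
    using assms(2)
  proof (induction xs arbitrary: ys zs)
    case (Cons x xs)
    have "x \<in> set ys" using mset_eq_setD[OF Cons.prems] by auto
    then obtain us vs where ys: "ys = us @ x # vs" by (meson split_list)
    have "mset xs = mset (us @ vs)" using Cons.prems ys by simp
    then have "pfaffian A ((zs @ [x]) @ xs) = pfaffian A ((zs @ [x]) @ us @ vs) \<or>
        pfaffian A ((zs @ [x]) @ xs) = - pfaffian A ((zs @ [x]) @ us @ vs)"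
      by (rule Cons.IH)
    moreover have "pfaffian A (zs @ ys) = pfaffian A (zs @ x # us @ vs) \<or>
        pfaffian A (zs @ ys) = - pfaffian A (zs @ x # us @ vs)"
      unfolding ys pfaffian_move[OF A, of zs us x vs]
      by (cases "even (length us)") auto
    ultimately show ?case by auto
  qed simp
  from this[of "[]"] show ?thesis by simp
qed

lemma pfaffian_not_distinct:
  assumes A: "alternating A" and "\<not> distinct xs"
  shows "pfaffian A xs = 0"
proof -
  obtain us vs ws y where "xs = us @ [y] @ vs @ [y] @ ws"
    using assms(2) not_distinct_decomp by blast
  then show ?thesis
    using pfaffian_move[OF A, of "us @ [y]" vs y ws] pfaffian_swap_repeat(2)[OF A, of us y "vs @ ws"] by simp
qed

section \<open>Complementary Pfaffians: contraction, wedge and derivative\<close>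

text \<open>
  The matrix of \<open>A\<close> bordered by an identity matrix: a Pfaffian with one label \<open>Inl i\<close> for
  every index \<open>i\<close> and labels \<open>Inr z\<close> for the members of a list is, up to sign, the Pfaffian of
  \<open>A\<close> with these members deleted. Thus complementary Pfaffians become alternating functions of
  the deleted indices, and no sign has to be tracked.
\<close>

fun bordered :: "('i \<Rightarrow> 'i \<Rightarrow> 'a::comm_ring_1) \<Rightarrow> 'i + 'i \<Rightarrow> 'i + 'i \<Rightarrow> 'a" where
  "bordered A (Inl i) (Inl j) = A i j"
| "bordered A (Inl i) (Inr j) = of_bool (i = j)"
| "bordered A (Inr i) (Inl j) = - of_bool (i = j)"
| "bordered A (Inr i) (Inr j) = 0"

lemma alternating_bordered:
  assumes "alternating A"
  shows "alternating (bordered A)"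
proof -
  have "bordered A q p = - bordered A p q" for p q
    by (cases p; cases q) (auto intro: alternatingD(1)[OF assms])
  moreover have "bordered A p p = 0" for p
    by (cases p) (auto intro: alternatingD(2)[OF assms])
  ultimately show ?thesis unfolding alternating_def by blast
qed

definition univ_list :: "'i::finite list" where
  "univ_list = (SOME xs. distinct xs \<and> set xs = UNIV)"

lemma univ_list: "distinct (univ_list :: 'i::finite list)" "set (univ_list :: 'i list) = UNIV"
proof -
  have "\<exists>xs :: 'i list. distinct xs \<and> set xs = UNIV"
    using finite_distinct_list[of "UNIV :: 'i set"] by auto
  then show "distinct (univ_list :: 'i list)" "set (univ_list :: 'i list) = UNIV"
    unfolding univ_list_def by (metis (mono_tags, lifting) someI_ex)+
qed

lemma length_univ_list: "length (univ_list :: 'i::finite list) = CARD('i)"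
  using distinct_card[OF univ_list(1)] univ_list(2) by metis

definition compl_pfaffian :: "('i::finite \<Rightarrow> 'i \<Rightarrow> 'a::comm_ring_1) \<Rightarrow> 'i list \<Rightarrow> 'a" where
  "compl_pfaffian A zs = pfaffian (bordered A) (map Inl univ_list @ map Inr zs)"

lemma compl_pfaffian_swap:
  assumes "alternating A"
  shows "compl_pfaffian A (xs @ x # y # ys) = - compl_pfaffian A (xs @ y # x # ys)"
  using pfaffian_swap_repeat(1)[OF alternating_bordered[OF assms],
    of "map Inl univ_list @ map Inr xs" "Inr x" "Inr y" "map Inr ys"]
  unfolding compl_pfaffian_def by simp

lemma compl_pfaffian_not_distinct:
  assumes "alternating A" "\<not> distinct xs"
  shows "compl_pfaffian A xs = 0"
proof -
  have "\<not> distinct (map Inl univ_list @ map Inr xs)"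
    using assms(2) by (simp add: distinct_map)
  then show ?thesis
    unfolding compl_pfaffian_def by (rule pfaffian_not_distinct[OF alternating_bordered[OF assms(1)]])
qed

lemma sum_delta_mult:
  fixes f :: "'i::finite \<Rightarrow> 'a::comm_ring_1"
  shows "(\<Sum>p\<in>UNIV. of_bool (p = a) * f p) = f a" "(\<Sum>p\<in>UNIV. of_bool (a = p) * f p) = f a"
    "(\<Sum>p\<in>UNIV. f p * of_bool (p = a)) = f a" "(\<Sum>p\<in>UNIV. f p * of_bool (a = p)) = f a"
proof -
  have *: "(\<Sum>p\<in>UNIV. if p = a then f p else 0) = f a" by simp
  have "of_bool (p = a) * f p = (if p = a then f p else 0)" for p by simp
  then show "(\<Sum>p\<in>UNIV. of_bool (p = a) * f p) = f a" by (simp only: *)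
  then show "(\<Sum>p\<in>UNIV. of_bool (a = p) * f p) = f a" "(\<Sum>p\<in>UNIV. f p * of_bool (p = a)) = f a"
    "(\<Sum>p\<in>UNIV. f p * of_bool (a = p)) = f a"
    by (simp_all only: eq_commute[of a] mult.commute[of "f _"])
qed

text \<open>The Pfaffian in which the label \<open>Inl r\<close> occurs twice is zero. Its expansion
  along the first copy pairs that label with the \<open>Inl\<close> labels, giving the left side,
  and with the \<open>Inr\<close> labels of the border, giving the right side.\<close>

lemma compl_pfaffian_contract:
  fixes A :: "'i::finite \<Rightarrow> 'i \<Rightarrow> 'a::comm_ring_1"
  assumes A: "alternating A"
  shows "(\<Sum>p\<in>UNIV. A r p * compl_pfaffian A (p # zs)) = (\<Sum>m<length zs. (-1) ^ m * of_bool (r = zs ! m) * compl_pfaffian A (del m zs))"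
proof -
  define R :: "'i list" where "R = univ_list"
  define P where "P m = (-1) ^ m * pfaffian (bordered A) (del m (map Inl R) @ map Inr zs)" for m
  have "set R = UNIV" unfolding R_def by (rule univ_list(2))
  then have "\<not> distinct (Inl r # map Inl R @ map Inr zs)" by simp
  then have "pfaffian (bordered A) (Inl r # map Inl R @ map Inr zs) = 0"
    by (rule pfaffian_not_distinct[OF alternating_bordered[OF A]])
  moreover have "pfaffian (bordered A) (Inl r # map Inl R @ map Inr zs) = (\<Sum>m<length R. A r (R ! m) * P m) +
      (-1) ^ length R * (\<Sum>m<length zs. (-1) ^ m * of_bool (r = zs ! m) * compl_pfaffian A (del m zs))"
    unfolding pfaffian_Cons_append sum_distrib_left length_map
    by (intro arg_cong2[where f = "(+)"] sum.cong refl) (simp_all add: P_def compl_pfaffian_def power_add map_del R_def)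
  ultimately have "(\<Sum>m<length R. A r (R ! m) * P m) +
      (-1) ^ length R * (\<Sum>m<length zs. (-1) ^ m * of_bool (r = zs ! m) * compl_pfaffian A (del m zs)) = 0"
    by (simp only:)
  then have 1: "(\<Sum>m<length R. A r (R ! m) * P m) =
      - ((-1) ^ length R * (\<Sum>m<length zs. (-1) ^ m * of_bool (r = zs ! m) * compl_pfaffian A (del m zs)))"
    by (rule eq_neg_iff_add_eq_0[THEN iffD2])
  \<comment> \<open>The row of \<open>Inr p\<close> has its only nonzero entry at
    \<open>Inl p\<close>, so expanding along it just deletes \<open>Inl p\<close>.\<close>
  have 2: "compl_pfaffian A (p # zs) = - ((-1) ^ length R * (\<Sum>m<length R. of_bool (p = R ! m) * P m))" for p
  proof -
    have "compl_pfaffian A (p # zs) = (-1) ^ length R * pfaffian (bordered A) (Inr p # map Inl R @ map Inr zs)"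
      using pfaffian_move[OF alternating_bordered[OF A], of "[]" "map Inl R"] by (simp add: compl_pfaffian_def R_def)
    also have "pfaffian (bordered A) (Inr p # map Inl R @ map Inr zs) = - (\<Sum>m<length R. of_bool (p = R ! m) * P m)"
      unfolding pfaffian_Cons_append by (simp add: P_def sum_negf mult_ac del: sum_mult_of_bool_eq sum_of_bool_mult_eq)
    finally show ?thesis by simp
  qed
  have "(\<Sum>p\<in>UNIV. A r p * compl_pfaffian A (p # zs)) = - ((-1) ^ length R * (\<Sum>p\<in>UNIV. \<Sum>m<length R. of_bool (p = R ! m) * (A r p * P m)))"
    unfolding 2 by (simp add: sum_distrib_left sum_negf mult_ac del: sum_mult_of_bool_eq sum_of_bool_mult_eq)
  also have "(\<Sum>p\<in>UNIV. \<Sum>m<length R. of_bool (p = R ! m) * (A r p * P m)) = (\<Sum>m<length R. \<Sum>p\<in>UNIV. of_bool (p = R ! m) * (A r p * P m))"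
    by (rule sum.swap)
  also have "\<dots> = (\<Sum>m<length R. A r (R ! m) * P m)"
    by (simp only: sum_delta_mult)
  finally show ?thesis
    unfolding 1 by (simp flip: mult.assoc power_add)
qed

text \<open>Weight \<open>compl_pfaffian_contract\<close> by \<open>x r\<close> and sum over
  \<open>r\<close>: the contracted side dies because \<open>x\<close> kills the matrix, and the
  Kronecker deltas on the other side leave the wedge with \<open>x\<close>.\<close>

lemma compl_pfaffian_wedge:
  fixes A :: "'i::finite \<Rightarrow> 'i \<Rightarrow> 'a::comm_ring_1"
  assumes A: "alternating A" and x: "\<And>p. (\<Sum>r\<in>UNIV. x r * A r p) = 0"
  shows "(\<Sum>m<length zs. (-1) ^ m * x (zs ! m) * compl_pfaffian A (del m zs)) = 0"
proof -
  have "(\<Sum>m<length zs. (-1) ^ m * x (zs ! m) * compl_pfaffian A (del m zs)) =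
      (\<Sum>m<length zs. \<Sum>r\<in>UNIV. of_bool (r = zs ! m) * (x r * (-1) ^ m * compl_pfaffian A (del m zs)))"
    by (simp only: sum_delta_mult mult.commute[of "x _"])
  also have "\<dots> = (\<Sum>r\<in>UNIV. \<Sum>m<length zs. of_bool (r = zs ! m) * (x r * (-1) ^ m * compl_pfaffian A (del m zs)))"
    by (rule sum.swap)
  also have "\<dots> = (\<Sum>r\<in>UNIV. x r * (\<Sum>p\<in>UNIV. A r p * compl_pfaffian A (p # zs)))"
    unfolding compl_pfaffian_contract[OF A] sum_distrib_left by (intro sum.cong refl) (simp only: mult_ac)
  also have "\<dots> = (\<Sum>p\<in>UNIV. \<Sum>r\<in>UNIV. x r * (A r p * compl_pfaffian A (p # zs)))"
    unfolding sum_distrib_left by (rule sum.swap)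
  also have "\<dots> = (\<Sum>p\<in>UNIV. (\<Sum>r\<in>UNIV. x r * A r p) * compl_pfaffian A (p # zs))"
    by (simp add: sum_distrib_right mult.assoc)
  finally show ?thesis by (simp add: x)
qed

text \<open>The derivative of a Pfaffian by the entry at \<open>p\<close>, \<open>q\<close> is the
  Pfaffian without these two indices. The border expresses this deletion by the labels
  \<open>Inr q\<close>, \<open>Inr p\<close>, in the order that makes the sign positive, and yields
  zero by itself if an index is already absent. Pairs \<open>p < q\<close> list the independent
  entries once.\<close>

lemma pfaffian_derivation:
  fixes A :: "'i::{finite,linorder} \<Rightarrow> 'i \<Rightarrow> 'a::comm_ring_1"
  assumes A: "alternating A"
    and add: "\<And>x y. D (x + y) = D x + D y" and mult: "\<And>x y. D (x * y) = D x * y + x * D y"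
  shows "even (length xs) \<Longrightarrow> D (pfaffian (bordered A) xs) =
     (\<Sum>p\<in>UNIV. \<Sum>q\<in>{p<..}. D (A p q) * pfaffian (bordered A) (xs @ [Inr q, Inr p]))"
proof (induction xs rule: length_induct)
  case (1 xs)
  have D0: "D 0 = 0" using add[of 0 0] by simp
  have D1: "D 1 = 0" using mult[of 1 1] by simp
  have Dm: "D (- x) = - D x" for x using add[of x "- x"] D0 by (simp add: eq_neg_iff_add_eq_0 add.commute)
  have Dp: "D ((-1) ^ m * x) = (-1) ^ m * D x" for m x
    by (induction m) (auto simp: Dm)
  have Dp1: "D ((-1) ^ m) = 0" for m
    using Dp[of m 1] by (simp add: D1)
  have Ds: "D (\<Sum>i<n. f i) = (\<Sum>i<n. D (f i))" for f and n :: nat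
    by (induction n) (auto simp: D0 add)
  show ?case
  proof (cases xs)
    case Nil
    have "pfaffian (bordered A) [Inr q, Inr p] = 0" for p q
      by (simp add: pfaffian_Cons lessThan_Suc)
    then show ?thesis by (simp add: Nil D1)
  next
    case (Cons i js)
    let ?B = "bordered A"
    have odd: "odd (length js)" using 1 Cons by simp
    have IH: "D (pfaffian ?B (del m js)) =
       (\<Sum>p\<in>UNIV. \<Sum>q\<in>{p<..}. D (A p q) * pfaffian ?B (del m js @ [Inr q, Inr p]))" if "m < length js" for m
      using 1(1) that Cons odd by simp
    have exp: "pfaffian ?B (i # js @ [Inr q, Inr p]) =
        (\<Sum>m<length js. (-1) ^ m * ?B i (js ! m) * pfaffian ?B (del m js @ [Inr q, Inr p])) +
        (?B i (Inr p) * pfaffian ?B (js @ [Inr q]) - ?B i (Inr q) * pfaffian ?B (js @ [Inr p]))" for p q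
      unfolding pfaffian_Cons_append using odd by (simp add: del_def lessThan_Suc numeral_2_eq_2)
    have rot: "pfaffian ?B (js @ [Inr q]) = (\<Sum>m<length js. (-1) ^ m * of_bool (js ! m = Inl q) * pfaffian ?B (del m js))" for q
    proof -
      have "?B (Inr q) s = - of_bool (s = Inl q)" for s by (cases s) auto
      then show ?thesis
        using pfaffian_move[OF alternating_bordered[OF A], of "[]" js "Inr q" "[]"] odd by (simp add: sum_negf pfaffian_Cons)
    qed
    \<comment> \<open>In the expansion along the first row, the terms pairing it with one of the two
      appended labels account for the derivatives of the entries of that row; the remaining terms
      are the induction hypothesis.\<close>
    have rest: "(\<Sum>p\<in>UNIV. \<Sum>q\<in>{p<..}. D (A p q) * (?B i (Inr p) * pfaffian ?B (js @ [Inr q]) - ?B i (Inr q) * pfaffian ?B (js @ [Inr p]))) =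
        (\<Sum>m<length js. (-1) ^ m * D (?B i (js ! m)) * pfaffian ?B (del m js))"
    proof (cases i)
      case (Inr r)
      have "D (?B (Inr r) s) = 0" for s by (cases s) (auto simp: D0 D1 Dm)
      then show ?thesis by (simp add: Inr)
    next
      case (Inl r)
      have DB: "(\<Sum>q\<in>UNIV. D (A r q) * of_bool (s = Inl q)) = D (?B i s)" for s
        by (cases s) (simp_all add: Inl D0 D1 sum_delta_mult del: sum_mult_of_bool_eq sum_of_bool_mult_eq)
      have anti: "D (A q p) = - D (A p q)" for p q using A Dm unfolding alternating_def by metis
      have diag: "D (A p p) = 0" for p using A D0 unfolding alternating_def by metis
      have "(\<Sum>p\<in>UNIV. \<Sum>q\<in>{p<..}. D (A p q) * (of_bool (r = p) * P q - of_bool (r = q) * P p)) =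
          (\<Sum>q\<in>UNIV. D (A r q) * P q)" for P
      proof -
        have "(\<Sum>p\<in>UNIV. \<Sum>q\<in>{p<..}. D (A p q) * (of_bool (r = p) * P q - of_bool (r = q) * P p)) =
          (\<Sum>p\<in>UNIV. of_bool (r = p) * (\<Sum>q\<in>{p<..}. D (A p q) * P q)) -
          (\<Sum>p\<in>UNIV. \<Sum>q\<in>{p<..}. of_bool (r = q) * (D (A p q) * P p))"
          by (simp add: sum_subtractf sum_distrib_left algebra_simps)
        also have "(\<Sum>p\<in>UNIV. of_bool (r = p) * (\<Sum>q\<in>{p<..}. D (A p q) * P q)) = (\<Sum>q\<in>{r<..}. D (A r q) * P q)"
          by (rule sum_delta_mult)
        also have "(\<Sum>p\<in>UNIV. \<Sum>q\<in>{p<..}. of_bool (r = q) * (D (A p q) * P p)) =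
            (\<Sum>p\<in>UNIV. if p < r then D (A p r) * P p else 0)"
        proof (intro sum.cong refl)
          fix p
          have "(\<Sum>q\<in>{p<..}. of_bool (r = q) * (D (A p q) * P p)) = (\<Sum>q\<in>{p<..}. if r = q then D (A p q) * P p else 0)"
            by (intro sum.cong refl) simp
          then show "(\<Sum>q\<in>{p<..}. of_bool (r = q) * (D (A p q) * P p)) = (if p < r then D (A p r) * P p else 0)"
            by (simp only: sum.delta' finite greaterThan_iff)
        qed
        also have "\<dots> = (\<Sum>p\<in>{..<r}. D (A p r) * P p)"
          by (intro sum.mono_neutral_cong_right) auto
        also have "(\<Sum>q\<in>{r<..}. D (A r q) * P q) - \<dots> = (\<Sum>q\<in>{r<..}. D (A r q) * P q) + (\<Sum>q\<in>{..<r}. D (A r q) * P q)"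
          unfolding anti[of r] by (simp add: sum_negf)
        also have "\<dots> = (\<Sum>q\<in>{r<..} \<union> {..<r}. D (A r q) * P q)"
          by (subst sum.union_disjoint) auto
        also have "\<dots> = (\<Sum>q\<in>UNIV. D (A r q) * P q)"
          by (intro sum.mono_neutral_left) (auto simp: diag not_less_iff_gr_or_eq)
        finally show ?thesis .
      qed
      then have "(\<Sum>p\<in>UNIV. \<Sum>q\<in>{p<..}. D (A p q) * (?B i (Inr p) * pfaffian ?B (js @ [Inr q]) - ?B i (Inr q) * pfaffian ?B (js @ [Inr p]))) =
          (\<Sum>q\<in>UNIV. D (A r q) * pfaffian ?B (js @ [Inr q]))"
        by (simp only: Inl bordered.simps)
      also have "\<dots> = (\<Sum>m<length js. (-1) ^ m * (\<Sum>q\<in>UNIV. D (A r q) * of_bool (js ! m = Inl q)) * pfaffian ?B (del m js))"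
        unfolding rot sum_distrib_left sum_distrib_right
        by (subst sum.swap) (simp add: mult_ac del: sum_mult_of_bool_eq sum_of_bool_mult_eq)
      finally show ?thesis unfolding DB .
    qed
    have "D (pfaffian ?B (i # js)) =
        (\<Sum>m<length js. (-1) ^ m * D (?B i (js ! m)) * pfaffian ?B (del m js)) +
        (\<Sum>m<length js. (-1) ^ m * ?B i (js ! m) * D (pfaffian ?B (del m js)))"
      by (simp add: pfaffian_Cons Ds Dp Dp1 mult mult.assoc distrib_left sum.distrib)
    also have "(\<Sum>m<length js. (-1) ^ m * ?B i (js ! m) * D (pfaffian ?B (del m js))) =
        (\<Sum>p\<in>UNIV. \<Sum>q\<in>{p<..}. D (A p q) *
          (\<Sum>m<length js. (-1) ^ m * ?B i (js ! m) * pfaffian ?B (del m js @ [Inr q, Inr p])))"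
    proof -
      have "(\<Sum>m<length js. (-1) ^ m * ?B i (js ! m) * D (pfaffian ?B (del m js))) =
         (\<Sum>m<length js. \<Sum>p\<in>UNIV. \<Sum>q\<in>{p<..}. D (A p q) * ((-1) ^ m * ?B i (js ! m) * pfaffian ?B (del m js @ [Inr q, Inr p])))"
        unfolding sum_distrib_left by (intro sum.cong) (simp_all add: IH sum_distrib_left mult_ac)
      also have "\<dots> = (\<Sum>p\<in>UNIV. \<Sum>q\<in>{p<..}. \<Sum>m<length js. D (A p q) * ((-1) ^ m * ?B i (js ! m) * pfaffian ?B (del m js @ [Inr q, Inr p])))"
        by (subst sum.swap, rule sum.cong[OF refl], rule sum.swap)
      finally show ?thesis by (simp add: sum_distrib_left)
    qed
    finally show ?thesis
      unfolding Cons append_Cons exp distrib_left sum.distrib rest by (simp add: add.commute)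
  qed
qed

lemma compl_pfaffian_derivation:
  fixes A :: "'i::{finite,linorder} \<Rightarrow> 'i \<Rightarrow> 'a::comm_ring_1"
  assumes "alternating A"
    and "\<And>x y. D (x + y) = D x + D y" and "\<And>x y. D (x * y) = D x * y + x * D y"
    and "even (CARD('i) + length zs)"
  shows "D (compl_pfaffian A zs) = (\<Sum>p\<in>UNIV. \<Sum>q\<in>{p<..}. D (A p q) * compl_pfaffian A (zs @ [q, p]))"
  unfolding compl_pfaffian_def using pfaffian_derivation[OF assms(1-3), of "map Inl univ_list @ map Inr zs"] assms(4)
  by (simp add: length_univ_list)

text \<open>Appending \<open>Inl z\<close>, \<open>Inr z\<close> to labels without
  \<open>Inl z\<close> leaves the Pfaffian unchanged, since \<open>Inr z\<close> can only be paired
  with \<open>Inl z\<close>. Doing so for all deleted \<open>z\<close> completes the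
  \<open>Inl\<close> labels, and reordering costs at most a sign.\<close>

lemma pfaffian_eq_compl_pfaffian:
  fixes A :: "'i::finite \<Rightarrow> 'i \<Rightarrow> 'a::comm_ring_1"
  assumes A: "alternating A" and "distinct xs" "distinct zs" "set zs = UNIV - set xs"
  shows "pfaffian A xs = compl_pfaffian A zs \<or> pfaffian A xs = - compl_pfaffian A zs"
proof -
  note B = alternating_bordered[OF A]
  define pairs :: "'i list \<Rightarrow> ('i + 'i) list" where "pairs zs = concat (map (\<lambda>z. [Inl z, Inr z]) zs)" for zs
  have step: "pfaffian (bordered A) (ws @ [Inl z, Inr z]) = pfaffian (bordered A) ws" if "Inl z \<notin> set ws" for ws z
  proof -
    have "bordered A (Inr z) w = 0" if "w \<noteq> Inl z" for w
      using that by (cases w) auto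
    then have "bordered A (Inr z) (ws ! m) = 0" if "m < length ws" for m
      using nth_mem[OF that] \<open>Inl z \<notin> set ws\<close> by metis
    then have "pfaffian (bordered A) (Inr z # ws @ [Inl z]) = - ((-1) ^ length ws * pfaffian (bordered A) ws)"
      unfolding pfaffian_Cons_append by (simp add: del_def lessThan_Suc)
    then show ?thesis
      using pfaffian_move[OF B, of "[]" "ws @ [Inl z]" "Inr z" "[]"]
      by (simp flip: power_add mult.assoc)
  qed
  have "pfaffian (bordered A) (map Inl xs @ pairs zs) = pfaffian (bordered A) (map Inl xs)"
    using assms(3,4)
  proof -
    have "distinct zs \<Longrightarrow> set zs \<inter> set xs = {} \<Longrightarrow>
      pfaffian (bordered A) (map Inl xs @ pairs zs) = pfaffian (bordered A) (map Inl xs)"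
    proof (induction zs rule: rev_induct)
      case (snoc z zs)
      have "pfaffian (bordered A) ((map Inl xs @ pairs zs) @ [Inl z, Inr z]) = pfaffian (bordered A) (map Inl xs @ pairs zs)"
        using snoc.prems by (intro step) (auto simp: pairs_def)
      then show ?case using snoc by (simp add: pairs_def)
    qed (simp add: pairs_def)
    then show ?thesis using assms(3,4) by auto
  qed
  moreover have "mset (map Inl xs @ pairs zs) = mset (map Inl univ_list @ map Inr zs)"
  proof -
    have "mset (xs @ zs) = mset univ_list"
      using assms univ_list by (intro set_eq_iff_mset_eq_distinct[THEN iffD1]) auto
    moreover have "mset (pairs zs) = mset (map Inl zs) + mset (map Inr zs)"
      by (induction zs) (auto simp: pairs_def)
    ultimately show ?thesis
      by (metis (no_types, lifting) add.assoc mset_append mset_map image_mset_union)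
  qed
  moreover have "pfaffian A xs = pfaffian (bordered A) (map Inl xs)"
    by (simp add: pfaffian_map)
  ultimately show ?thesis
    using pfaffian_perm[OF B, of "map Inl xs @ pairs zs" "map Inl univ_list @ map Inr zs"]
    by (simp add: compl_pfaffian_def)
qed

section \<open>Ideals and their localizations\<close>

interpretation ideal: Modules.module "(*) :: 'a::comm_ring_1 \<Rightarrow> 'a \<Rightarrow> 'a"
  by unfold_locales (simp_all add: algebra_simps)

(* Here this rule is associativity from right to left, which loops with mult.assoc. *)
declare ideal.scale_scale [simp del]

lemma mem_ideal_of: "x \<in> P \<Longrightarrow> x \<in> ideal_of P"
  by (simp add: ideal_of_def ideal.span_base)

lemma subspace_ideal_of: "ideal.subspace (ideal_of P)"
  by (simp add: ideal_of_def)

lemma ideal_of_minimal: "P \<subseteq> L \<Longrightarrow> ideal.subspace L \<Longrightarrow> ideal_of P \<subseteq> L"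
  by (simp add: ideal_of_def ideal.span_minimal)

text \<open>
  Nakayama's lemma without quotient modules: \<open>\<theta>\<close> is a nonzero linear functional on the fibre at
  \<open>a\<close> of the module generated by the \<open>f s\<close> modulo \<open>L\<close>. It reads off the coefficient of one
  member of a minimal generating subfamily.
\<close>

lemma nakayama_functional:
  fixes f :: "'s \<Rightarrow> ('i::finite, 'a::field) mpoly"
  assumes S: "finite S" and L: "ideal.subspace L" and sat: "\<And>g p. eval a g \<noteq> 0 \<Longrightarrow> g * p \<in> L \<Longrightarrow> p \<in> L"
    and s0: "s0 \<in> S" "f s0 \<notin> L"
  obtains \<theta> where "\<exists>s\<in>S. \<theta> s \<noteq> 0"
    and "\<And>Q. (\<Sum>s\<in>S. Q s * f s) \<in> L \<Longrightarrow> (\<Sum>s\<in>S. eval a (Q s) * \<theta> s) = 0"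
proof -
  \<comment> \<open>The subfamily on \<open>B\<close> generates all \<open>f s\<close> modulo
    \<open>L\<close> once polynomials nonzero at \<open>a\<close> are inverted. A smallest such
    \<open>B\<close> plays the role of a basis of the fibre.\<close>
  define gen where "gen B \<longleftrightarrow> B \<subseteq> S \<and>
    (\<forall>s\<in>S. \<exists>g r. eval a g \<noteq> 0 \<and> g * f s - (\<Sum>t\<in>B. r t * f t) \<in> L)" for B
  have "gen S"
    unfolding gen_def
  proof (intro conjI ballI subset_refl)
    fix s assume s: "s \<in> S"
    have "(\<Sum>t\<in>S. (if t = s then 1 else 0) * f t) = (\<Sum>t\<in>S. if t = s then f t else 0)"
      by (intro sum.cong) auto
    then have "1 * f s - (\<Sum>t\<in>S. (if t = s then 1 else 0) * f t) \<in> L"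
      using S s ideal.subspace_0[OF L] by simp
    then show "\<exists>g r. eval a g \<noteq> 0 \<and> g * f s - (\<Sum>t\<in>S. r t * f t) \<in> L"
      by (intro exI[of _ 1] exI[of _ "\<lambda>t. if t = s then 1 else 0"]) simp
  qed
  then obtain B where B: "gen B" and min: "\<And>C. gen C \<Longrightarrow> card B \<le> card C"
    using ex_has_least_nat[of gen S card] by blast
  have BS: "B \<subseteq> S" and finB: "finite B"
    using B S finite_subset by (auto simp: gen_def)
  have "B \<noteq> {}"
  proof
    assume "B = {}"
    then obtain g where "eval a g \<noteq> 0" "g * f s0 \<in> L"
      using B s0(1) by (auto simp: gen_def)
    then show False using sat s0(2) by blast
  qed
  then obtain t0 where t0: "t0 \<in> B" by blast
  \<comment> \<open>If the coefficient of \<open>t0\<close> in a relation were a unit at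
    \<open>a\<close>, the relation would eliminate \<open>t0\<close> and contradict
    minimality.\<close>
  have indep: "eval a (q t0) = 0" if q: "(\<Sum>t\<in>B. q t * f t) \<in> L" for q
  proof (rule ccontr)
    assume q0: "eval a (q t0) \<noteq> 0"
    have "gen (B - {t0})"
      unfolding gen_def
    proof (intro conjI ballI)
      show "B - {t0} \<subseteq> S" using BS by blast
      fix s assume "s \<in> S"
      then obtain g r where g: "eval a g \<noteq> 0" and r: "g * f s - (\<Sum>t\<in>B. r t * f t) \<in> L"
        using B by (auto simp: gen_def)
      define c where "c t = q t0 * r t - r t0 * q t" for t
      have c: "(\<Sum>t\<in>B. c t * f t) = q t0 * (\<Sum>t\<in>B. r t * f t) - r t0 * (\<Sum>t\<in>B. q t * f t)"
        unfolding sum_distrib_left sum_subtractf[symmetric]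
        by (intro sum.cong refl) (simp only: c_def left_diff_distrib mult.assoc)
      have "q t0 * (g * f s - (\<Sum>t\<in>B. r t * f t)) + r t0 * (\<Sum>t\<in>B. q t * f t) \<in> L"
        by (intro ideal.subspace_add[OF L] ideal.subspace_scale[OF L] q r)
      also have "q t0 * (g * f s - (\<Sum>t\<in>B. r t * f t)) + r t0 * (\<Sum>t\<in>B. q t * f t) =
          (q t0 * g) * f s - (\<Sum>t\<in>B. c t * f t)"
        unfolding c by (simp add: right_diff_distrib mult.assoc)
      also have "(\<Sum>t\<in>B. c t * f t) = (\<Sum>t\<in>B - {t0}. c t * f t)"
        using sum.remove[OF finB t0, of "\<lambda>t. c t * f t"] by (simp add: c_def mult.commute)
      finally show "\<exists>g r. eval a g \<noteq> 0 \<and> g * f s - (\<Sum>t\<in>B - {t0}. r t * f t) \<in> L"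
        using g q0 by (intro exI[of _ "q t0 * g"] exI[of _ c]) (auto simp: eval_mult)
    qed
    from min[OF this] show False
      using card_Diff1_less[OF finB t0] by simp
  qed
  have "\<forall>s. \<exists>g r. s \<in> S \<longrightarrow> eval a g \<noteq> 0 \<and> g * f s - (\<Sum>t\<in>B. r t * f t) \<in> L"
    using B by (auto simp: gen_def)
  then obtain g r where g: "\<And>s. s \<in> S \<Longrightarrow> eval a (g s) \<noteq> 0"
    and r: "\<And>s. s \<in> S \<Longrightarrow> g s * f s - (\<Sum>t\<in>B. r s t * f t) \<in> L"
    by metis
  \<comment> \<open>The coefficient of \<open>f t0\<close> in \<open>f s\<close> at the point
    \<open>a\<close>. By \<open>indep\<close> it is well defined on the fibre, and it is 1 at
    \<open>t0\<close>.\<close>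
  define \<theta> where "\<theta> s = eval a (r s t0) / eval a (g s)" for s
  have "\<theta> t0 = 1"
  proof -
    have t0S: "t0 \<in> S" using t0 BS by blast
    have "g t0 * f t0 = (\<Sum>t\<in>B. if t = t0 then g t0 * f t else 0)"
      using t0 finB by simp
    also have "\<dots> - (\<Sum>t\<in>B. r t0 t * f t) = (\<Sum>t\<in>B. ((if t = t0 then g t0 else 0) - r t0 t) * f t)"
      unfolding sum_subtractf[symmetric] by (intro sum.cong) (auto simp: algebra_simps)
    finally have "(\<Sum>t\<in>B. ((if t = t0 then g t0 else 0) - r t0 t) * f t) \<in> L"
      using r[OF t0S] by simp
    from indep[OF this] show ?thesis
      using g[OF t0S] by (simp add: \<theta>_def eval_diff)
  qed
  moreover have "(\<Sum>s\<in>S. eval a (Q s) * \<theta> s) = 0" if Q: "(\<Sum>s\<in>S. Q s * f s) \<in> L" for Q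
  proof -
    \<comment> \<open>Clearing all denominators \<open>g s\<close> at once with the product
      \<open>H\<close> turns a relation over \<open>S\<close> into one over \<open>B\<close>, to
      which \<open>indep\<close> applies.\<close>
    define G where "G s = (\<Prod>s'\<in>S - {s}. g s')" for s
    define H where "H = (\<Prod>s\<in>S. g s)"
    have H: "H = G s * g s" if "s \<in> S" for s
      using prod.remove[OF S that, of g] by (simp add: H_def G_def mult.commute)
    have "H * (\<Sum>s\<in>S. Q s * f s) - (\<Sum>s\<in>S. (Q s * G s) * (g s * f s - (\<Sum>t\<in>B. r s t * f t))) \<in> L"
      by (intro ideal.subspace_diff[OF L] ideal.subspace_scale[OF L] ideal.subspace_sum[OF L] Q r)
    also have "H * (\<Sum>s\<in>S. Q s * f s) = (\<Sum>s\<in>S. (Q s * G s) * (g s * f s))"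
      unfolding sum_distrib_left by (intro sum.cong refl) (simp add: H mult_ac)
    also have "(\<Sum>s\<in>S. (Q s * G s) * (g s * f s)) - (\<Sum>s\<in>S. (Q s * G s) * (g s * f s - (\<Sum>t\<in>B. r s t * f t))) =
        (\<Sum>s\<in>S. \<Sum>t\<in>B. Q s * G s * r s t * f t)"
      unfolding sum_subtractf[symmetric] by (intro sum.cong refl) (simp add: sum_distrib_left algebra_simps)
    also have "\<dots> = (\<Sum>t\<in>B. (\<Sum>s\<in>S. Q s * G s * r s t) * f t)"
      unfolding sum_distrib_right by (rule sum.swap)
    finally have "eval a (\<Sum>s\<in>S. Q s * G s * r s t0) = 0" by (rule indep)
    moreover have "eval a (\<Sum>s\<in>S. Q s * G s * r s t0) = (\<Sum>s\<in>S. eval a H * (eval a (Q s) * \<theta> s))"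
      unfolding eval_sum using g by (intro sum.cong refl) (simp add: H eval_mult \<theta>_def)
    ultimately have "eval a H * (\<Sum>s\<in>S. eval a (Q s) * \<theta> s) = 0"
      by (simp add: sum_distrib_left)
    moreover have "eval a H \<noteq> 0"
      using S g by (simp add: H_def eval_prod)
    ultimately show ?thesis by simp
  qed
  ultimately show ?thesis
    using that[of \<theta>] t0 BS by (metis subsetD zero_neq_one)
qed

text \<open>Relations between Pfaffians are naturally indexed by something other than
  \<open>S\<close>, possibly with repetitions. Adding up coefficients over the fibres of
  \<open>h\<close> brings them into the form that the functional handles.\<close>

lemma sum_reindex_functional:
  fixes f :: "'s \<Rightarrow> ('i::finite, 'a::field) mpoly"
  assumes S: "finite S" and \<theta>: "\<forall>Q. (\<Sum>s\<in>S. Q s * f s) \<in> L \<longrightarrow> (\<Sum>s\<in>S. eval a (Q s) * \<theta> s) = 0"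
    and T: "finite T" "h ` T \<subseteq> S" and Q: "(\<Sum>t\<in>T. Q t * f (h t)) \<in> L"
  shows "(\<Sum>t\<in>T. eval a (Q t) * \<theta> (h t)) = 0"
proof -
  define Q' where "Q' s = (\<Sum>t\<in>{t\<in>T. h t = s}. Q t)" for s
  have "(\<Sum>t\<in>T. Q t * f (h t)) = (\<Sum>s\<in>S. Q' s * f s)"
    unfolding sum.group[OF T(1) S T(2), symmetric] Q'_def sum_distrib_right by (intro sum.cong refl) auto
  then have "0 = (\<Sum>s\<in>S. eval a (Q' s) * \<theta> s)"
    using Q \<theta> by simp
  also have "\<dots> = (\<Sum>t\<in>T. eval a (Q t) * \<theta> (h t))"
    unfolding sum.group[OF T(1) S T(2), symmetric] Q'_def eval_sum sum_distrib_right by (intro sum.cong refl) auto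
  finally show ?thesis by simp
qed

lemma ideal_of_hom_comp:
  fixes Q :: "('i::finite, 'a::comm_ring_1) mpoly set"
  assumes Q: "\<And>q. q \<in> Q \<Longrightarrow> \<exists>e. homogeneous e q" and p: "p \<in> ideal_of Q"
  shows "hom_comp d p \<in> ideal_of Q"
proof -
  have "p \<in> ideal.span Q" using p by (simp add: ideal_of_def)
  then have "hom_comp d p \<in> ideal.span Q"
  proof (induction rule: ideal.span_induct_alt)
    case base
    then show ?case by (simp add: ideal.span_zero)
  next
    case (step c x y)
    obtain e where e: "homogeneous e x" using Q step by blast
    have "hom_comp d (c * x) \<in> ideal.span Q"
    proof (cases "e \<le> d")
      case True
      then have "hom_comp d (c * x) = hom_comp (d - e) c * x"
        using hom_comp_mult_homogeneous[OF e, of "d - e" c] by simp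
      then show ?thesis using step by (simp add: ideal.span_scale ideal.span_base)
    next
      case False
      then show ?thesis
        using hom_comp_mult_homogeneous_less[OF e, of d c] by (simp add: ideal.span_zero)
    qed
    then show ?case using step by (simp add: hom_comp_add ideal.span_add)
  qed
  then show ?thesis by (simp add: ideal_of_def)
qed

text \<open>Some homogeneous component of \<open>g\<close> is nonzero at \<open>a\<close>; its
  product with the homogeneous \<open>p\<close> is a component of \<open>g * p\<close>, and the
  ideal contains the components of its members.\<close>

lemma homogeneous_denominator:
  fixes Q :: "('i::finite, 'a::comm_ring_1) mpoly set"
  assumes Q: "\<And>q. q \<in> Q \<Longrightarrow> \<exists>e. homogeneous e q" and p: "homogeneous e p"
    and g: "eval a g \<noteq> 0" "g * p \<in> ideal_of Q"
  shows "\<exists>h d. homogeneous d h \<and> eval a h \<noteq> 0 \<and> h * p \<in> ideal_of Q"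
proof -
  obtain d where d: "eval a (hom_comp d g) \<noteq> 0" using eval_hom_comp[OF g(1)] by blast
  have "hom_comp (d + e) (g * p) \<in> ideal_of Q" by (rule ideal_of_hom_comp[OF Q g(2)])
  then have "hom_comp d g * p \<in> ideal_of Q" by (simp add: hom_comp_mult_homogeneous[OF p])
  then show ?thesis using d homogeneous_hom_comp by blast
qed

text \<open>Only generators need checking, because the polynomials that enter
  \<open>ideal_of P\<close> after multiplication by a homogeneous \<open>g\<close> nonzero at
  \<open>a\<close> form an ideal.\<close>

lemma ideal_stalk_subset:
  fixes P Q :: "('i::finite, 'a::field) mpoly set"
  assumes Q: "\<And>q. q \<in> Q \<Longrightarrow> \<exists>g e. homogeneous e g \<and> eval a g \<noteq> 0 \<and> g * q \<in> ideal_of P"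
  shows "ideal_stalk (ideal_of Q) a \<subseteq> ideal_stalk (ideal_of P) a"
proof -
  define L where "L = {p. \<exists>g e. homogeneous e g \<and> eval a g \<noteq> 0 \<and> g * p \<in> ideal_of P}"
  have "ideal.subspace L"
    unfolding ideal.subspace_def
  proof (intro conjI ballI allI)
    show "0 \<in> L"
      using homogeneous_1 ideal.subspace_0[OF subspace_ideal_of, of P]
      unfolding L_def by (intro CollectI exI[of _ 1] exI[of _ 0]) auto
    fix p q assume "p \<in> L" "q \<in> L"
    then obtain g e h d where g: "homogeneous e g" "eval a g \<noteq> 0" "g * p \<in> ideal_of P"
      and h: "homogeneous d h" "eval a h \<noteq> 0" "h * q \<in> ideal_of P"
      by (auto simp: L_def)
    have "h * (g * p) + g * (h * q) \<in> ideal_of P"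
      by (intro ideal.subspace_add[OF subspace_ideal_of] ideal.subspace_scale[OF subspace_ideal_of] g h)
    then have "(g * h) * (p + q) \<in> ideal_of P" by (simp add: algebra_simps)
    then show "p + q \<in> L"
      unfolding L_def using homogeneous_mult[OF g(1) h(1)] g(2) h(2)
      by (intro CollectI exI[of _ "g * h"] exI[of _ "e + d"]) (auto simp: eval_mult)
  next
    fix c p assume "p \<in> L"
    then obtain g e where g: "homogeneous e g" "eval a g \<noteq> 0" "g * p \<in> ideal_of P"
      by (auto simp: L_def)
    have "g * (c * p) \<in> ideal_of P"
      using ideal.subspace_scale[OF subspace_ideal_of g(3), of c] by (simp add: mult.left_commute)
    then show "c * p \<in> L" using g by (auto simp: L_def)
  qed
  then have sub: "ideal_of Q \<subseteq> L"
    using Q by (intro ideal_of_minimal) (auto simp: L_def)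
  show ?thesis
  proof
    fix p assume "p \<in> ideal_stalk (ideal_of Q) a"
    then obtain g e where p: "\<exists>d. homogeneous d p" and g: "homogeneous e g" "eval a g \<noteq> 0" "g * p \<in> ideal_of Q"
      by (auto simp: ideal_stalk_def)
    from g(3) obtain h d where h: "homogeneous d h" "eval a h \<noteq> 0" "h * (g * p) \<in> ideal_of P"
      using sub by (auto simp: L_def)
    have "\<exists>g e. homogeneous e g \<and> eval a g \<noteq> 0 \<and> g * p \<in> ideal_of P"
      using homogeneous_mult[OF h(1) g(1)] g(2) h
      by (intro exI[of _ "h * g"] exI[of _ "d + e"]) (simp add: eval_mult mult.assoc)
    then show "p \<in> ideal_stalk (ideal_of P) a"
      unfolding ideal_stalk_def using p by blast
  qed
qed

text \<open>The contraction to the polynomial ring of the extension of \<open>J\<close> to the local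
  ring at \<open>a\<close> of affine space. Denominators are arbitrary here, matching
  \<open>nakayama_functional\<close>.\<close>

definition saturation :: "('i::finite \<Rightarrow> 'a::field) \<Rightarrow> ('i, 'a) mpoly set \<Rightarrow> ('i, 'a) mpoly set" where
  "saturation a J = {p. \<exists>g. eval a g \<noteq> 0 \<and> g * p \<in> J}"

lemma saturation_superset: "J \<subseteq> saturation a J"
  by (auto simp: saturation_def intro!: exI[of _ 1])

lemma subspace_saturation:
  assumes J: "ideal.subspace J"
  shows "ideal.subspace (saturation a J)"
  unfolding ideal.subspace_def
proof (intro conjI ballI allI)
  show "0 \<in> saturation a J" using saturation_superset ideal.subspace_0[OF J] by blast
  fix p q assume "p \<in> saturation a J" "q \<in> saturation a J"
  then obtain g h where g: "eval a g \<noteq> 0" "g * p \<in> J" and h: "eval a h \<noteq> 0" "h * q \<in> J"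
    by (auto simp: saturation_def)
  have "(g * h) * (p + q) = h * (g * p) + g * (h * q)" by (simp add: algebra_simps)
  also have "\<dots> \<in> J" by (intro ideal.subspace_add[OF J] ideal.subspace_scale[OF J] g h)
  finally show "p + q \<in> saturation a J"
    unfolding saturation_def using g h by (intro CollectI exI[of _ "g * h"]) (simp add: eval_mult)
next
  fix c p assume "p \<in> saturation a J"
  then obtain g where g: "eval a g \<noteq> 0" "g * p \<in> J" by (auto simp: saturation_def)
  have "g * (c * p) \<in> J" using ideal.subspace_scale[OF J g(2), of c] by (simp add: mult.left_commute)
  then show "c * p \<in> saturation a J" using g(1) by (auto simp: saturation_def)
qed

lemma saturation_saturated:
  assumes "eval a g \<noteq> 0" "g * p \<in> saturation a J"
  shows "p \<in> saturation a J"
proof -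
  obtain h where "eval a h \<noteq> 0" "h * (g * p) \<in> J" using assms(2) by (auto simp: saturation_def)
  then show ?thesis
    unfolding saturation_def using assms(1) by (intro CollectI exI[of _ "h * g"]) (simp add: eval_mult mult.assoc)
qed

section \<open>Instability\<close>

lemma infinite_UNIV_alg_closed: "infinite (UNIV :: 'a::alg_closed_field set)"
proof
  assume fin: "finite (UNIV :: 'a set)"
  define p :: "'a poly" where "p = (\<Prod>a\<in>UNIV. [:- a, 1:])"
  have "degree p = card (UNIV :: 'a set)"
    unfolding p_def by (subst degree_prod_eq_sum_degree) auto
  moreover have "card (UNIV :: 'a set) > 0" using fin by (simp add: card_gt_0_iff)
  ultimately have "degree (p + 1) > 0" by (subst degree_add_eq_left) auto
  then obtain z where "poly (p + 1) z = 0" using alg_closed_imp_poly_has_root by blast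
  moreover have "poly p z = 0"
    unfolding p_def poly_prod using fin by (auto simp: prod_zero_iff)
  ultimately show False by simp
qed

section \<open>The group action and destabilising one-parameter subgroups\<close>

definition trilinear :: "'a::comm_ring_1 tensor3 \<Rightarrow> 'a ^ 9 \<Rightarrow> 'a ^ 9 \<Rightarrow> 'a ^ 9 \<Rightarrow> 'a" where
  "trilinear u x y z = (\<Sum>p\<in>UNIV. \<Sum>q\<in>UNIV. \<Sum>r\<in>UNIV. x $ p * y $ q * z $ r * u (p, q, r))"

text \<open>The rows of \<open>g\<close> act as a basis of the dual space, on which the form of
  \<open>u\<close> is evaluated. So a group element can be replaced by a basis adapted to the
  situation.\<close>

lemma act_eq_trilinear: "act g u (i, j, l) = trilinear u (g $ i) (g $ j) (g $ l)"
  by (simp add: act_def trilinear_def)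

lemma trilinear_sum:
  "trilinear u (\<Sum>i\<in>I. c i *s Y i) y z = (\<Sum>i\<in>I. c i * trilinear u (Y i) y z)"
  "trilinear u x (\<Sum>i\<in>I. c i *s Y i) z = (\<Sum>i\<in>I. c i * trilinear u x (Y i) z)"
  "trilinear u x y (\<Sum>i\<in>I. c i *s Y i) = (\<Sum>i\<in>I. c i * trilinear u x y (Y i))"
proof -
  have add: "trilinear u (v + w) y z = trilinear u v y z + trilinear u w y z"
    "trilinear u x (v + w) z = trilinear u x v z + trilinear u x w z"
    "trilinear u x y (v + w) = trilinear u x y v + trilinear u x y w" for x y z v w
    by (simp_all add: trilinear_def algebra_simps sum.distrib)
  have scale: "trilinear u (c *s v) y z = c * trilinear u v y z"
    "trilinear u x (c *s v) z = c * trilinear u x v z"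
    "trilinear u x y (c *s v) = c * trilinear u x y v" for x y z v c
    by (simp_all add: trilinear_def sum_distrib_left mult_ac)
  have zero: "trilinear u 0 y z = 0" "trilinear u x 0 z = 0" "trilinear u x y 0 = 0" for x y z
    by (simp_all add: trilinear_def)
  show "trilinear u (\<Sum>i\<in>I. c i *s Y i) y z = (\<Sum>i\<in>I. c i * trilinear u (Y i) y z)"
    by (induction I rule: infinite_finite_induct) (simp_all add: add scale zero)
  show "trilinear u x (\<Sum>i\<in>I. c i *s Y i) z = (\<Sum>i\<in>I. c i * trilinear u x (Y i) z)"
    by (induction I rule: infinite_finite_induct) (simp_all add: add scale zero)
  show "trilinear u x y (\<Sum>i\<in>I. c i *s Y i) = (\<Sum>i\<in>I. c i * trilinear u x y (Y i))"
    by (induction I rule: infinite_finite_induct) (simp_all add: add scale zero)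
qed

lemma trilinear_scale:
  "trilinear u (c *s x) (d *s y) (e *s z) = c * d * e * trilinear u x y z"
  by (simp add: trilinear_def sum_distrib_left mult_ac)

lemma act_mult: "act (g ** h) u = act g (act h u)"
proof
  fix t :: "9 \<times> 9 \<times> 9"
  obtain i j l where t: "t = (i, j, l)" by (cases t)
  have row: "(g ** h) $ i = (\<Sum>a\<in>UNIV. g $ i $ a *s h $ a)" for i
    by (simp add: vec_eq_iff matrix_matrix_mult_def)
  show "act (g ** h) u t = act g (act h u) t"
    unfolding t act_eq_trilinear row
    unfolding trilinear_sum(1)
    unfolding trilinear_sum(2)
    unfolding trilinear_sum(3)
    unfolding trilinear_def[of "act h u"] act_eq_trilinear by (simp add: sum_distrib_left mult_ac)
qed

lemma act_diagonal:
  fixes D :: "'a::comm_ring_1 ^ 9 ^ 9"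
  assumes "\<And>i j. D $ i $ j = (if i = j then d i else 0)"
  shows "act D u (i, j, l) = d i * d j * d l * u (i, j, l)"
proof -
  have *: "(\<Sum>p\<in>UNIV. D $ i $ p * f p) = d i * f i" for i f
  proof -
    have "(\<Sum>p\<in>UNIV. D $ i $ p * f p) = (\<Sum>p\<in>UNIV. if i = p then d i * f p else 0)"
      by (intro sum.cong refl) (simp add: assms)
    then show ?thesis by simp
  qed
  have "act D u (i, j, l) = (\<Sum>p\<in>UNIV. D $ i $ p * (\<Sum>q\<in>UNIV. D $ j $ q * (\<Sum>r\<in>UNIV. D $ l $ r * u (p, q, r))))"
    by (simp add: act_def sum_distrib_left mult_ac)
  then show ?thesis unfolding * by (simp add: mult_ac)
qed

lemma act_mu3: "h \<in> mu3 \<Longrightarrow> act h u = u"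
  by (auto simp: mu3_def mat_def act_diagonal[where d = "\<lambda>_. z" for z] fun_eq_iff power3_eq_cube)

lemma SL9_orbit_eq: "SL9_orbit u = {act g u |g. det g = 1}"
proof -
  have one: "mat 1 \<in> mu3" by (auto simp: mu3_def)
  show ?thesis
  proof (intro subset_antisym subsetI)
    fix v assume "v \<in> SL9_orbit u"
    then show "v \<in> {act g u |g. det g = 1}"
      by (auto simp: SL9_orbit_def FactGroup_def RCOSETS_def r_coset_def SL9_def act_mult act_mu3)
  next
    fix v assume "v \<in> {act g u |g. det g = 1}"
    then obtain g where g: "v = act g u" "det g = 1" by auto
    have "g \<in> mu3 #>\<^bsub>SL9\<^esub> g"
      using one matrix_mul_lid[of g] unfolding r_coset_def SL9_def by force
    moreover have "mu3 #>\<^bsub>SL9\<^esub> g \<in> carrier (SL9 Mod mu3)"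
      using g(2) by (auto simp: FactGroup_def RCOSETS_def SL9_def)
    ultimately show "v \<in> SL9_orbit u" using g(1) unfolding SL9_orbit_def by blast
  qed
qed

lemma finite_mu3: "finite (mu3 :: ('a::field ^ 9 ^ 9) set)"
proof -
  define p :: "'a poly" where "p = monom 1 3 - 1"
  have "coeff p 3 = 1" by (simp add: p_def)
  then have "p \<noteq> 0" by auto
  then have "finite {z. poly p z = 0}" by (rule poly_roots_finite)
  then have "finite {z :: 'a. z ^ 3 = 1}" by (simp add: p_def poly_monom)
  then show ?thesis by (simp add: mu3_def setcompr_eq_image)
qed

text \<open>\<open>stabilizer\<close> counts cosets; each of them is finite because
  \<open>mu3\<close> consists of scalars that are roots of one polynomial.\<close>

lemma finite_fixing:
  fixes u :: "'a::field tensor3"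
  assumes "finite (stabilizer u)"
  shows "finite {g. det g = 1 \<and> act g u = u}"
proof -
  have one: "(mat 1 :: 'a ^ 9 ^ 9) \<in> mu3" by (auto simp: mu3_def)
  have fin: "finite C" if "C \<in> stabilizer u" for C
    using that finite_mu3
    by (auto simp: stabilizer_def FactGroup_def RCOSETS_def r_coset_def SL9_def)
  have "{g. det g = 1 \<and> act g u = u} \<subseteq> \<Union>(stabilizer u)"
  proof
    fix g assume "g \<in> {g. det g = 1 \<and> act g u = u}"
    then have g: "det g = 1" "act g u = u" by auto
    have "(\<Union>h\<in>mu3. {h ** g}) \<in> stabilizer u"
      using g by (auto simp: stabilizer_def FactGroup_def RCOSETS_def r_coset_def SL9_def act_mult act_mu3)
    moreover have "g \<in> (\<Union>h\<in>mu3. {h ** g})" using one matrix_mul_lid[of g] by force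
    ultimately show "g \<in> \<Union>(stabilizer u)" by blast
  qed
  then show ?thesis using fin assms finite_subset by (meson finite_Union)
qed

lemma prod_power_int:
  fixes t :: "'a::field"
  assumes "t \<noteq> 0"
  shows "(\<Prod>i\<in>I. t powi w i) = t powi (\<Sum>i\<in>I. w i)"
  by (induction I rule: infinite_finite_induct) (simp_all add: power_int_add assms)

text \<open>
  The easy direction of the Hilbert-Mumford criterion: if all weights on \<open>u\<close> of a one-parameter
  subgroup are nonnegative, then the limit at \<open>0\<close> exists, lies in the closed orbit of \<open>u\<close>, and is
  fixed by the subgroup, so that the stabilizer is infinite.
\<close>

lemma destabilising_diagonal:
  fixes u :: "'a::alg_closed_field tensor3"
  assumes fin: "finite (stabilizer u)" and closed: "zariski_closed (SL9_orbit u)"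
    and h: "det h = 1" and w: "(\<Sum>i\<in>UNIV. w i) = (0::int)" "w i0 > 0"
    and wt: "\<And>i j l. act h u (i, j, l) \<noteq> 0 \<Longrightarrow> w i + w j + w l \<ge> 0"
  shows False
proof -
  define v where "v = act h u"
  define D :: "'a \<Rightarrow> 'a ^ 9 ^ 9" where "D s = (\<chi> i j. if i = j then s powi w i else 0)" for s
  define n where "n = (\<lambda>(i, j, l). nat (w i + w j + w l))"
  define v0 where "v0 = (\<lambda>(i, j, l). if w i + w j + w l = 0 then v (i, j, l) else 0)"
  have det_D: "det (D s) = 1" if "s \<noteq> 0" for s
  proof -
    have "det (D s) = (\<Prod>i\<in>UNIV. D s $ i $ i)" by (rule det_diagonal) (simp add: D_def)
    also have "\<dots> = s powi (\<Sum>i\<in>UNIV. w i)" using prod_power_int[OF that] by (simp add: D_def)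
    finally show ?thesis using w by simp
  qed
  have act_D: "act (D s) x (i, j, l) = s powi (w i + w j + w l) * x (i, j, l)" if "s \<noteq> 0" for s x i j l
    using act_diagonal[of "D s" "\<lambda>i. s powi w i"] that by (simp add: D_def power_int_add)
  have "v0 \<in> SL9_orbit u"
  proof -
    obtain P where P: "SL9_orbit u = {a. \<forall>p\<in>P. eval a p = 0}"
      using closed by (auto simp: zariski_closed_def)
    have "eval v0 p = 0" if "p \<in> P" for p
    proof -
      \<comment> \<open>The equation \<open>p\<close> of the orbit restricted to the curve
        \<open>act (D s) v\<close>, as a polynomial in \<open>s\<close>. It vanishes for all
        \<open>s\<close> except possibly 0, hence identically, hence at the limit point.\<close>
      define q where "q = (\<Sum>m\<in>Poly_Mapping.keys p.
        [:Poly_Mapping.lookup p m:] * (\<Prod>t\<in>UNIV. monom (v t) (n t) ^ Poly_Mapping.lookup m t))"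
      have q: "poly q s = eval (\<lambda>t. v t * s ^ n t) p" for s
        by (simp add: q_def eval_def poly_sum poly_prod poly_monom poly_power)
      have "poly q s = 0" if s: "s \<noteq> 0" for s
      proof -
        have "act (D s) v = (\<lambda>t. v t * s ^ n t)"
        proof
          fix t :: "9 \<times> 9 \<times> 9"
          obtain i j l where t: "t = (i, j, l)" by (cases t)
          show "act (D s) v t = v t * s ^ n t"
          proof (cases "v t = 0")
            case False
            then have "w i + w j + w l \<ge> 0" using wt t by (simp add: v_def)
            then show ?thesis by (simp add: t act_D[OF s] n_def power_int_def mult.commute)
          qed (simp add: t act_D[OF s])
        qed
        moreover have "act (D s) v = act (D s ** h) u" by (simp add: v_def act_mult)
        moreover have "det (D s ** h) = 1" by (simp add: det_mul det_D[OF s] h)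
        ultimately have "(\<lambda>t. v t * s ^ n t) \<in> SL9_orbit u"
          unfolding SL9_orbit_eq by (metis (mono_tags, lifting) mem_Collect_eq)
        then show ?thesis using P \<open>p \<in> P\<close> q by auto
      qed
      then have "UNIV - {0} \<subseteq> {s. poly q s = 0}" by auto
      moreover have "infinite (UNIV - {0} :: 'a set)"
        using infinite_UNIV_alg_closed[where 'a = 'a] by (simp add: infinite_remove)
      ultimately have "q = 0" using poly_roots_finite[of q] finite_subset by blast
      then have "eval (\<lambda>t. v t * 0 ^ n t) p = 0" using q[of 0] by simp
      \<comment> \<open>Because \<open>0 ^ 0 = 1\<close>, exactly the coordinates of weight zero
        survive.\<close>
      moreover have "(\<lambda>t. v t * 0 ^ n t) = v0"
      proof
        fix t :: "9 \<times> 9 \<times> 9"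
        obtain i j l where t: "t = (i, j, l)" by (cases t)
        show "v t * 0 ^ n t = v0 t"
          using wt[of i j l] by (cases "v t = 0") (auto simp: t v0_def n_def v_def)
      qed
      ultimately show ?thesis by simp
    qed
    then show ?thesis using P by auto
  qed
  then obtain g where g: "v0 = act g u" "det g = 1" unfolding SL9_orbit_eq by auto
  obtain g' where g': "g ** g' = mat 1" "g' ** g = mat 1"
    using g(2) invertible_det_nz[of g] by (auto simp: invertible_def)
  then have det_g': "det g' = 1" using det_mul[of g g'] g(2) by simp
  define F where "F = {x. det x = 1 \<and> act x u = u}"
  \<comment> \<open>The subgroup fixes \<open>v0 = act g u\<close>, so conjugating it by
    \<open>g\<close> lands in the stabilizer of \<open>u\<close>.\<close>
  have D_F: "D s \<in> (\<lambda>x. g ** x ** g') ` F" if s: "s \<noteq> 0" for s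
  proof -
    have "act (D s) v0 = v0"
      by (auto simp: fun_eq_iff act_D[OF s] v0_def)
    then have "act (g' ** D s ** g) u = act g' (act g u)"
      by (simp add: act_mult flip: g(1))
    also have "\<dots> = act (mat 1) u" unfolding act_mult[symmetric] g' ..
    also have "\<dots> = u" by (rule act_mu3) (auto simp: mu3_def)
    finally have "g' ** D s ** g \<in> F"
      by (simp add: F_def det_mul det_g' g(2) det_D[OF s])
    moreover have "D s = g ** (g' ** D s ** g) ** g'"
      using g' by (metis matrix_mul_assoc matrix_mul_lid matrix_mul_rid)
    ultimately show ?thesis by blast
  qed
  \<comment> \<open>The diagonal entry at \<open>i0\<close> is \<open>s ^ N\<close> with
    \<open>N > 0\<close>. A finite stabilizer would leave finitely many values for it, each attained
    by finitely many \<open>s\<close>.\<close>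
  define N where "N = nat (w i0)"
  define C where "C = (\<lambda>x. (g ** x ** g') $ i0 $ i0) ` F"
  have finC: "finite C" unfolding C_def F_def by (intro finite_imageI finite_fixing fin)
  have "s ^ N \<in> C" if "s \<noteq> 0" for s
  proof -
    have "s ^ N = D s $ i0 $ i0" using w(2) by (simp add: D_def N_def power_int_def)
    moreover obtain x where "x \<in> F" "D s = g ** x ** g'" using D_F \<open>s \<noteq> 0\<close> by blast
    ultimately show ?thesis unfolding C_def by (metis (no_types, lifting) image_eqI)
  qed
  then have "UNIV - {0} \<subseteq> (\<Union>c\<in>C. {s. s ^ N = c})" by auto
  moreover have "finite {s :: 'a. s ^ N = c}" for c
  proof -
    define p :: "'a poly" where "p = monom 1 N - [:c:]"
    have "coeff p N = 1" using w(2) by (simp add: p_def N_def coeff_pCons split: nat.split)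
    then have "p \<noteq> 0" by auto
    then show ?thesis using poly_roots_finite[of p] by (simp add: p_def poly_monom)
  qed
  ultimately have "finite (UNIV - {0} :: 'a set)"
    using finC finite_subset by blast
  then show False using infinite_UNIV_alg_closed[where 'a = 'a] by (simp add: infinite_remove)
qed

text \<open>The basis vectors become the rows of a matrix. Dividing one row by the determinant moves
  it into the special linear group without changing which coefficients of the form vanish.\<close>

lemma destabilising_basis:
  fixes u :: "'a::alg_closed_field tensor3"
  assumes fin: "finite (stabilizer u)" and closed: "zariski_closed (SL9_orbit u)"
    and B: "vec.independent B" "card B = 9"
    and W: "(\<Sum>x\<in>B. W x) = (0::int)" "\<exists>x\<in>B. W x > 0"
    and wt: "\<And>x y z. x \<in> B \<Longrightarrow> y \<in> B \<Longrightarrow> z \<in> B \<Longrightarrow> trilinear u x y z \<noteq> 0 \<Longrightarrow> W x + W y + W z \<ge> 0"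
  shows False
proof -
  have "finite B" using B(2) card.infinite by fastforce
  then obtain f where f: "bij_betw f (UNIV :: 9 set) B"
    using finite_same_card_bij[of "UNIV :: 9 set" B] B(2) by auto
  define h :: "'a ^ 9 ^ 9" where "h = (\<chi> i. f i)"
  have fB: "f i \<in> B" for i using f by (auto simp: bij_betw_def)
  have "det h \<noteq> 0"
  proof -
    have "\<forall>c. (\<Sum>i\<in>UNIV. c i *s row i h) = 0 \<longrightarrow> (\<forall>i. c i = 0)"
    proof (intro allI impI)
      fix c i assume c: "(\<Sum>i\<in>UNIV. c i *s row i h) = 0"
      define d where "d x = c (the_inv_into UNIV f x)" for x
      have inv: "the_inv_into UNIV f (f i) = i" for i
        using f by (simp add: bij_betw_def the_inv_into_f_f)
      have "row i h = f i" for i by (simp add: h_def row_def vec_eq_iff)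
      then have "(\<Sum>i\<in>UNIV. d (f i) *s f i) = 0" using c by (simp add: d_def inv)
      then have "(\<Sum>x\<in>B. d x *s x) = 0"
        using sum.reindex_bij_betw[OF f, of "\<lambda>x. d x *s x"] by simp
      then have "d (f i) = 0"
        using vec.independentD[OF B(1) \<open>finite B\<close> subset_refl, of d] fB by blast
      then show "c i = 0" by (simp add: d_def inv)
    qed
    then obtain g where "h ** g = mat 1"
      using matrix_right_invertible_independent_rows[of h] by blast
    then have "det h * det g = 1" by (metis det_I det_mul)
    then show ?thesis by auto
  qed
  define c where "c i = (if i = 0 then 1 / det h else 1)" for i :: 9
  define h' :: "'a ^ 9 ^ 9" where "h' = (\<chi> i. c i *s f i)"
  have "det h' = 1"
  proof -
    have "h' = (\<chi> i. if i = 0 then (1 / det h) *s f i else f i)"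
      by (simp add: h'_def c_def vec_eq_iff)
    also have "det \<dots> = (1 / det h) * det (\<chi> i. if i = 0 then f i else f i)"
      by (rule det_row_mul)
    also have "(\<chi> i. if i = 0 then f i else f i) = h" by (simp add: h_def)
    finally show ?thesis using \<open>det h \<noteq> 0\<close> by simp
  qed
  moreover have "(\<Sum>i\<in>UNIV. W (f i)) = 0"
    using sum.reindex_bij_betw[OF f, of W] W(1) by simp
  moreover obtain i0 where "W (f i0) > 0" using W(2) f by (auto simp: bij_betw_def)
  moreover have "W (f i) + W (f j) + W (f l) \<ge> 0" if "act h' u (i, j, l) \<noteq> 0" for i j l
    using that wt[OF fB fB fB] by (auto simp: act_eq_trilinear h'_def trilinear_scale)
  ultimately show False
    using destabilising_diagonal[OF fin closed, of h' "\<lambda>i. W (f i)" i0] by blast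
qed

section \<open>Trivectors as alternating forms, and splitting of bivectors\<close>

lemma sum_off_diagonal:
  fixes f :: "'i::{finite,linorder} \<Rightarrow> 'i \<Rightarrow> 'a::comm_monoid_add"
  shows "(\<Sum>p\<in>UNIV. \<Sum>q\<in>UNIV. f p q) = (\<Sum>p\<in>UNIV. f p p) + (\<Sum>p\<in>UNIV. \<Sum>q\<in>{p<..}. f p q + f q p)"
proof -
  have split: "(\<Sum>q\<in>UNIV. g q) = g p + (\<Sum>q\<in>{p<..}. g q) + (\<Sum>q\<in>{..<p}. g q)" for g :: "'i \<Rightarrow> 'a" and p
  proof -
    have "(UNIV :: 'i set) = insert p ({p<..} \<union> {..<p})" by auto
    then have "(\<Sum>q\<in>UNIV. g q) = (\<Sum>q\<in>insert p ({p<..} \<union> {..<p}). g q)" by simp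
    also have "\<dots> = g p + (\<Sum>q\<in>{p<..} \<union> {..<p}. g q)" by (rule sum.insert) auto
    also have "(\<Sum>q\<in>{p<..} \<union> {..<p}. g q) = (\<Sum>q\<in>{p<..}. g q) + (\<Sum>q\<in>{..<p}. g q)"
      by (rule sum.union_disjoint) auto
    finally show ?thesis by (simp only: add.assoc)
  qed
  have "(\<Sum>p\<in>UNIV. \<Sum>q\<in>{..<p}. f p q) = (\<Sum>p\<in>UNIV. \<Sum>q\<in>{q\<in>UNIV. q < p}. f p q)"
    by (simp add: lessThan_def)
  also have "\<dots> = (\<Sum>q\<in>UNIV. \<Sum>p\<in>{p\<in>UNIV. q < p}. f p q)"
    by (rule sum.swap_restrict) auto
  also have "\<dots> = (\<Sum>p\<in>UNIV. \<Sum>q\<in>{p<..}. f q p)"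
    by (simp add: greaterThan_def)
  finally have swap: "(\<Sum>p\<in>UNIV. \<Sum>q\<in>{..<p}. f p q) = (\<Sum>p\<in>UNIV. \<Sum>q\<in>{p<..}. f q p)" .
  have "(\<Sum>p\<in>UNIV. \<Sum>q\<in>UNIV. f p q) =
      (\<Sum>p\<in>UNIV. f p p + (\<Sum>q\<in>{p<..}. f p q) + (\<Sum>q\<in>{..<p}. f p q))"
    by (rule sum.cong[OF refl split])
  then show ?thesis
    by (simp only: sum.distrib swap add.assoc)
qed

lemma trivectorD:
  assumes "trivector u"
  shows "u (j, i, l) = - u (i, j, l)" "u (i, l, j) = - u (i, j, l)" "u (i, i, l) = 0" "u (i, l, l) = 0"
    "u (l, j, i) = - u (i, j, l)"
proof -
  show *: "u (j, i, l) = - u (i, j, l)" "u (i, l, j) = - u (i, j, l)" "u (i, i, l) = 0" "u (i, l, l) = 0" for i j l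
    using assms unfolding trivector_def by blast+
  show "u (l, j, i) = - u (i, j, l)"
    using *(1)[of l j i] *(2)[of j l i] *(1)[of j i l] by simp
qed

lemma trilinear_alternating:
  assumes u: "trivector u"
  shows "trilinear u y x z = - trilinear u x y z" "trilinear u x z y = - trilinear u x y z" "trilinear u x x z = 0"
proof -
  have "trilinear u y x z = (\<Sum>q\<in>UNIV. \<Sum>p\<in>UNIV. \<Sum>r\<in>UNIV. y $ p * x $ q * z $ r * u (p, q, r))"
    unfolding trilinear_def by (rule sum.swap)
  also have "\<dots> = (\<Sum>q\<in>UNIV. \<Sum>p\<in>UNIV. \<Sum>r\<in>UNIV. - (x $ q * y $ p * z $ r * u (q, p, r)))"
    by (intro sum.cong refl, subst trivectorD(1)[OF u]) simp
  finally show "trilinear u y x z = - trilinear u x y z" by (simp only: trilinear_def sum_negf)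
  have "trilinear u x z y = (\<Sum>p\<in>UNIV. \<Sum>r\<in>UNIV. \<Sum>q\<in>UNIV. x $ p * z $ q * y $ r * u (p, q, r))"
    unfolding trilinear_def by (intro sum.cong refl sum.swap)
  also have "\<dots> = (\<Sum>p\<in>UNIV. \<Sum>r\<in>UNIV. \<Sum>q\<in>UNIV. - (x $ p * y $ r * z $ q * u (p, r, q)))"
    by (intro sum.cong refl, subst trivectorD(2)[OF u]) simp
  finally show "trilinear u x z y = - trilinear u x y z" by (simp only: trilinear_def sum_negf)
  define g where "g p q = (\<Sum>r\<in>UNIV. x $ p * x $ q * z $ r * u (p, q, r))" for p q
  have "g p q + g q p = 0" for p q
    unfolding g_def sum.distrib[symmetric] by (intro sum.neutral ballI, subst trivectorD(1)[OF u]) simp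
  moreover have "g p p = 0" for p
    by (simp add: g_def trivectorD(3)[OF u])
  ultimately have "(\<Sum>p\<in>UNIV. \<Sum>q\<in>UNIV. g p q) = 0"
    unfolding sum_off_diagonal by simp
  then show "trilinear u x x z = 0"
    by (simp add: trilinear_def g_def)
qed

lemma trilinear_axis: "trilinear u x y z = (\<Sum>j\<in>UNIV. z $ j * trilinear u x y (axis j 1))"
  by (subst basis_expansion[of z, symmetric]) (rule trilinear_sum(3))

lemma trilinear_wedge:
  assumes u: "trivector u"
  shows "(\<Sum>p\<in>UNIV. \<Sum>q\<in>{p<..}. u (p, q, j) * (b $ p * c $ q - c $ p * b $ q)) = trilinear u b c (axis j 1)"
proof -
  have "(\<Sum>r\<in>UNIV. s * axis j 1 $ r * u (p, q, r)) = s * u (p, q, j)" for p q s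
  proof -
    have "(\<Sum>r\<in>UNIV. s * axis j 1 $ r * u (p, q, r)) = (\<Sum>r\<in>UNIV. if j = r then s * u (p, q, r) else 0)"
      by (intro sum.cong refl) (simp add: axis_def)
    then show ?thesis by simp
  qed
  then have "trilinear u b c (axis j 1) = (\<Sum>p\<in>UNIV. \<Sum>q\<in>UNIV. b $ p * c $ q * u (p, q, j))"
    by (simp add: trilinear_def)
  also have "\<dots> = (\<Sum>p\<in>UNIV. \<Sum>q\<in>{p<..}. b $ p * c $ q * u (p, q, j) + b $ q * c $ p * u (q, p, j))"
    unfolding sum_off_diagonal by (simp add: trivectorD(3)[OF u])
  also have "\<dots> = (\<Sum>p\<in>UNIV. \<Sum>q\<in>{p<..}. u (p, q, j) * (b $ p * c $ q - c $ p * b $ q))"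
    by (intro sum.cong refl, subst trivectorD(1)[OF u]) (simp add: algebra_simps)
  finally show ?thesis by simp
qed

text \<open>One step of symplectic elimination: \<open>b\<close> and \<open>c\<close> are the
  columns \<open>p\<close> and \<open>q\<close>, one of them scaled, and subtracting their wedge
  clears the rows \<open>p\<close> and \<open>q\<close>. The coordinates at \<open>p\<close> and
  \<open>q\<close> later certify that \<open>b\<close> and \<open>c\<close> are independent of
  everything split off from the remainder.\<close>

lemma symplectic_step:
  fixes \<omega> :: "'n::finite \<Rightarrow> 'n \<Rightarrow> 'a::field"
  assumes \<omega>: "alternating \<omega>" and pq: "\<omega> p q \<noteq> 0" and V: "vec.subspace V" and cols: "\<And>j. (\<chi> i. \<omega> i j) \<in> V"
  obtains b c :: "'a ^ 'n" and \<omega>' :: "'n \<Rightarrow> 'n \<Rightarrow> 'a" where "alternating \<omega>'" "\<And>i j. \<omega> i j = b $ i * c $ j - c $ i * b $ j + \<omega>' i j"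
    "b \<in> V" "c \<in> V" "b $ p = 0" "b $ q \<noteq> 0" "c $ p \<noteq> 0" "c $ q = 0"
    "\<And>j. (\<chi> i. \<omega>' i j) \<in> V" "\<And>j. \<omega>' p j = 0" "\<And>j. \<omega>' q j = 0"
proof -
  note anti = alternatingD(1)[OF \<omega>] and diag = alternatingD(2)[OF \<omega>]
  define b where "b = (1 / \<omega> p q) *s (\<chi> i. \<omega> i p)"
  define c where "c = (\<chi> i. \<omega> i q)"
  define \<omega>' where "\<omega>' i j = \<omega> i j - (b $ i * c $ j - c $ i * b $ j)" for i j
  have b: "b \<in> V" unfolding b_def by (intro vec.subspace_scale V cols)
  have c: "c \<in> V" unfolding c_def by (rule cols)
  have qp: "\<omega> q p = - \<omega> p q" by (rule anti)
  have "alternating \<omega>'"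
    unfolding alternating_def
  proof (intro conjI allI)
    fix i j
    have "\<omega> j i = - \<omega> i j" by (rule anti)
    then show "\<omega>' j i = - \<omega>' i j" by (simp add: \<omega>'_def)
    show "\<omega>' i i = 0" by (simp add: \<omega>'_def diag mult.commute)
  qed
  moreover have "(\<chi> i. \<omega>' i j) \<in> V" for j
  proof -
    have "(\<chi> i. \<omega>' i j) = (\<chi> i. \<omega> i j) - (c $ j *s b - b $ j *s c)"
      by (simp add: vec_eq_iff \<omega>'_def mult.commute)
    then show ?thesis by (simp add: vec.subspace_diff vec.subspace_scale V cols b c)
  qed
  moreover have "\<omega>' p j = 0" "\<omega>' q j = 0" for j
    using pq qp anti[of p j] anti[of q j] by (simp_all add: \<omega>'_def b_def c_def diag)
  moreover have "b $ p = 0" "b $ q \<noteq> 0" "c $ p \<noteq> 0" "c $ q = 0"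
    using pq qp by (simp_all add: b_def c_def diag)
  moreover have "\<omega> i j = b $ i * c $ j - c $ i * b $ j + \<omega>' i j" for i j
    by (simp add: \<omega>'_def)
  ultimately show ?thesis using that b c by blast
qed

lemma subspace_coordinate_zero: "vec.subspace {v :: 'a::field ^ 'n. v $ p = 0}"
  by (simp add: vec.subspace_def)

lemma independent_insert_coordinate:
  fixes v :: "'a::field ^ 'n" and S :: "('a ^ 'n) set"
  assumes "vec.independent S" "\<And>x. x \<in> S \<Longrightarrow> x $ p = 0" "v $ p \<noteq> 0"
  shows "vec.independent (insert v S)" "v \<notin> S"
proof -
  have "vec.span S \<subseteq> {v. v $ p = 0}"
    using assms(2) by (intro vec.span_minimal subspace_coordinate_zero) auto
  then have "v \<notin> vec.span S" using assms(3) by auto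
  then show "vec.independent (insert v S)" "v \<notin> S"
    using assms(1) vec.span_base by (auto simp: vec.independent_insert)
qed

text \<open>The weight is the constant \<open>w\<close> outside \<open>S\<close>, so every extension
  of \<open>S\<close> to a basis works; the \<open>9 - card S\<close> added vectors balance the
  total weight to zero.\<close>

lemma destabilising_independent:
  fixes u :: "'a::alg_closed_field tensor3"
  assumes fin: "finite (stabilizer u)" and closed: "zariski_closed (SL9_orbit u)"
    and S: "vec.independent S" "finite S" "card S < 9"
    and W: "(\<Sum>x\<in>S. W x) + (9 - int (card S)) * w = 0" "\<And>x. x \<notin> S \<Longrightarrow> W x = w" "w > 0"
    and wt: "\<And>x y z. trilinear u x y z \<noteq> 0 \<Longrightarrow> W x + W y + W z \<ge> 0"
  shows False
proof -
  define B where "B = vec.extend_basis S"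
  have B: "S \<subseteq> B" "vec.independent B" "vec.span B = UNIV"
    using vec.extend_basis_superset[OF S(1)] vec.independent_extend_basis[OF S(1)] vec.span_extend_basis[OF S(1)]
    by (auto simp: B_def)
  have "card B = 9"
    using vec.dim_eq_card[of B UNIV] B(2,3) vec_dim_card[where 'a = 'a and 'n = 9] by simp
  then have finB: "finite B" using card.infinite by fastforce
  have "card (B - S) = 9 - card S" using B(1) S(2) \<open>card B = 9\<close> by (simp add: card_Diff_subset)
  then have "B - S \<noteq> {}" using S(3) by (intro notI) simp
  then obtain x where "x \<in> B" "W x > 0" using W(2,3) by force
  moreover have "(\<Sum>x\<in>B. W x) = 0"
  proof -
    have "(\<Sum>x\<in>B. W x) = (\<Sum>x\<in>S. W x) + (\<Sum>x\<in>B - S. W x)"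
      using sum.subset_diff[OF B(1) finB, of W] by simp
    also have "(\<Sum>x\<in>B - S. W x) = (\<Sum>x\<in>B - S. w)" by (intro sum.cong) (auto simp: W(2))
    finally show ?thesis using W(1) S(3) \<open>card (B - S) = 9 - card S\<close> by simp
  qed
  ultimately show False
    using destabilising_basis[OF fin closed B(2) \<open>card B = 9\<close>, of W] wt by blast
qed

text \<open>
  Write \<open>\<omega>\<close> as a sum of \<open>r\<close> products \<open>b\<^sub>i \<and> c\<^sub>i\<close> with \<open>a\<close> and all \<open>b\<^sub>i\<close>, \<open>c\<^sub>i\<close>
  independent. The destabilising weights of \<open>a\<close>, of \<open>b\<^sub>i\<close> and \<open>c\<^sub>i\<close> (three pairs suffice), and
  of the rest of a basis are \<open>-2, -2, 1\<close> if \<open>r = 1\<close>, \<open>-4, -1, 2\<close> if \<open>r = 2\<close> and \<open>-2, 0, 1\<close> if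
  \<open>r \<ge> 3\<close>. For \<open>r = 2\<close> this uses that \<open>u\<close> vanishes on the span of the \<open>b\<^sub>i\<close> and \<open>c\<^sub>i\<close>,
  because it does so on the bivector \<open>\<omega>\<close>.
\<close>

lemma not_stable_of_form:
  fixes u :: "'a::alg_closed_field tensor3"
  assumes u: "trivector u" and fin: "finite (stabilizer u)" and closed: "zariski_closed (SL9_orbit u)"
    and a: "(a :: 'a ^ 9) $ k \<noteq> 0" and \<omega>: "alternating \<omega>" "\<omega> p0 q0 \<noteq> 0" "\<And>q. \<omega> k q = 0"
    and ker: "\<And>r q. (\<Sum>p\<in>UNIV. (\<Sum>l\<in>UNIV. u (r, p, l) * a $ l) * \<omega> p q) = 0"
    and contract: "\<And>j. (\<Sum>p\<in>UNIV. \<Sum>q\<in>{p<..}. u (p, q, j) * \<omega> p q) = 0"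
  shows False
proof -
  note alt = trilinear_alternating[OF u]
  \<comment> \<open>The kernel of the matrix at \<open>a\<close>, cut down by the
    \<open>k\<close>-th coordinate to a complement of the line of \<open>a\<close>. Every vector
    split off from \<open>\<omega>\<close> stays in it.\<close>
  define V where "V = {v. v $ k = 0 \<and> (\<forall>y. trilinear u a v y = 0)}"
  have V: "vec.subspace V"
    by (auto simp: vec.subspace_def V_def trilinear_def algebra_simps sum.distrib simp flip: sum_distrib_left)
  have cols: "(\<chi> i. \<omega> i q) \<in> V" for q
  proof -
    have "trilinear u a (\<chi> i. \<omega> i q) y = 0" for y
    proof -
      have "trilinear u a (\<chi> i. \<omega> i q) y = (\<Sum>l\<in>UNIV. \<Sum>p\<in>UNIV. \<Sum>r\<in>UNIV. - (y $ r * (u (r, p, l) * a $ l * \<omega> p q)))"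
        unfolding trilinear_def by (intro sum.cong refl, subst trivectorD(5)[OF u]) simp
      also have "\<dots> = (\<Sum>p\<in>UNIV. \<Sum>l\<in>UNIV. \<Sum>r\<in>UNIV. - (y $ r * (u (r, p, l) * a $ l * \<omega> p q)))"
        by (rule sum.swap)
      also have "\<dots> = (\<Sum>p\<in>UNIV. \<Sum>r\<in>UNIV. \<Sum>l\<in>UNIV. - (y $ r * (u (r, p, l) * a $ l * \<omega> p q)))"
        by (intro sum.cong refl sum.swap)
      also have "\<dots> = (\<Sum>r\<in>UNIV. \<Sum>p\<in>UNIV. \<Sum>l\<in>UNIV. - (y $ r * (u (r, p, l) * a $ l * \<omega> p q)))"
        by (rule sum.swap)
      also have "\<dots> = (\<Sum>r\<in>UNIV. - (y $ r * (\<Sum>p\<in>UNIV. (\<Sum>l\<in>UNIV. u (r, p, l) * a $ l) * \<omega> p q)))"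
        by (simp only: sum_distrib_left sum_distrib_right sum_negf)
      finally show ?thesis by (simp only: ker) simp
    qed
    then show ?thesis using \<omega>(3) by (simp add: V_def)
  qed
  \<comment> \<open>The contraction of the form with \<open>x\<close> and \<open>y\<close> vanishes.
    A triple with nonzero coefficient contains no such pair, which bounds how many vectors of
    negative weight can meet in it.\<close>
  define N where "N x y \<longleftrightarrow> (\<forall>z. trilinear u x y z = 0)" for x y
  have N_refl: "N x x" for x by (simp add: N_def alt(3))
  have N_sym: "N y x" if "N x y" for x y
    using that unfolding N_def by (metis alt(1) neg_equal_0_iff_equal)
  have N: "\<not> N x y" "\<not> N x z" "\<not> N y z" if "trilinear u x y z \<noteq> 0" for x y z
    using that unfolding N_def by (metis alt(1,2) neg_equal_0_iff_equal)+
  have NV: "N a v" if "v \<in> V" for v using that by (simp add: V_def N_def)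
  have perm: "trilinear u x z y = 0 \<and> trilinear u y x z = 0 \<and> trilinear u y z x = 0 \<and> trilinear u z x y = 0 \<and> trilinear u z y x = 0"
    if "trilinear u x y z = 0" for x y z
    using that by (metis alt(1,2) neg_equal_0_iff_equal)
  have a_new: "vec.independent (insert a S)" "a \<notin> S" if "vec.independent S" "S \<subseteq> V" for S
    using independent_insert_coordinate[of S k a] that a by (auto simp: V_def)
  \<comment> \<open>Vectors split off later have zero coordinates at \<open>p\<close> and
    \<open>q\<close>, while these two coordinates distinguish \<open>b\<close> and
    \<open>c\<close>.\<close>
  have pair: "vec.independent (insert b (insert c S))" "c \<notin> S" "b \<notin> insert c S"
    if "vec.independent S" "\<And>x. x \<in> S \<Longrightarrow> x $ p = 0" "\<And>x. x \<in> S \<Longrightarrow> x $ q = 0"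
      "b $ p = 0" "b $ q \<noteq> 0" "c $ p \<noteq> 0" "c $ q = 0" for b c :: "'a ^ 9" and S :: "('a ^ 9) set" and p q
  proof -
    show c: "c \<notin> S" and "vec.independent (insert b (insert c S))" "b \<notin> insert c S"
      using independent_insert_coordinate[of S p c] independent_insert_coordinate[of "insert c S" q b] that by auto
  qed
  obtain b1 c1 :: "'a ^ 9" and \<omega>1 where 1: "alternating \<omega>1" "\<And>i j. \<omega> i j = b1 $ i * c1 $ j - c1 $ i * b1 $ j + \<omega>1 i j"
    "b1 \<in> V" "c1 \<in> V" "b1 $ p0 = 0" "b1 $ q0 \<noteq> 0" "c1 $ p0 \<noteq> 0" "c1 $ q0 = 0"
    "\<And>j. (\<chi> i. \<omega>1 i j) \<in> V" "\<And>j. \<omega>1 p0 j = 0" "\<And>j. \<omega>1 q0 j = 0"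
    using symplectic_step[OF \<omega>(1,2) V cols] by metis
  show False
  proof (cases "\<forall>i j. \<omega>1 i j = 0")
    case True
    have "trilinear u b1 c1 (axis j 1) = 0" for j
      using contract[of j] trilinear_wedge[OF u, of j b1 c1] by (simp add: 1(2) True)
    then have "N b1 c1" unfolding N_def by (subst trilinear_axis) simp
    then have NS: "N x y" if "x \<in> {a, b1, c1}" "y \<in> {a, b1, c1}" for x y
      using that NV 1(3,4) N_sym N_refl by auto
    have S: "vec.independent {b1, c1}" "b1 \<noteq> c1"
      using pair[of "{}" p0 q0 b1 c1] 1 vec.independent_empty by auto
    then have indep: "vec.independent {a, b1, c1}" "a \<notin> {b1, c1}" using a_new[of "{b1, c1}"] 1(3,4) by auto
    define W :: "'a ^ 9 \<Rightarrow> int" where "W x = (if x \<in> {a, b1, c1} then -2 else 1)" for x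
    show False
    proof (rule destabilising_independent[OF fin closed indep(1), of W 1])
      show "W x + W y + W z \<ge> 0" if "trilinear u x y z \<noteq> 0" for x y z
        using N[OF that] NS unfolding W_def by auto
    qed (use S(2) indep(2) in \<open>auto simp: W_def\<close>)
  next
    case False
    then obtain p1 q1 where pq1: "\<omega>1 p1 q1 \<noteq> 0" by blast
    define V1 where "V1 = V \<inter> ({v. v $ p0 = 0} \<inter> {v. v $ q0 = 0})"
    have V1: "vec.subspace V1"
      unfolding V1_def by (intro vec.subspace_inter V subspace_coordinate_zero)
    have cols1: "(\<chi> i. \<omega>1 i j) \<in> V1" for j
      using 1(9)[of j] by (simp add: V1_def 1(10,11))
    obtain b2 c2 :: "'a ^ 9" and \<omega>2 where 2: "alternating \<omega>2" "\<And>i j. \<omega>1 i j = b2 $ i * c2 $ j - c2 $ i * b2 $ j + \<omega>2 i j"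
      "b2 \<in> V1" "c2 \<in> V1" "b2 $ p1 = 0" "b2 $ q1 \<noteq> 0" "c2 $ p1 \<noteq> 0" "c2 $ q1 = 0"
      "\<And>j. (\<chi> i. \<omega>2 i j) \<in> V1" "\<And>j. \<omega>2 p1 j = 0" "\<And>j. \<omega>2 q1 j = 0"
      using symplectic_step[OF 1(1) pq1 V1 cols1] by metis
    show False
    proof (cases "\<forall>i j. \<omega>2 i j = 0")
      case True
      have S2: "vec.independent {b2, c2}" "b2 \<noteq> c2"
        using pair[of "{}" p1 q1 b2 c2] 2 vec.independent_empty by auto
      then have S: "vec.independent {b1, c1, b2, c2}" "c1 \<notin> {b2, c2}" "b1 \<notin> {c1, b2, c2}"
        using pair[of "{b2, c2}" p0 q0 b1 c1] 1(5-8) 2(3,4) by (auto simp: V1_def)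
      have QV: "{b1, c1, b2, c2} \<subseteq> V" using 1(3,4) 2(3,4) by (auto simp: V1_def)
      have indep: "vec.independent {a, b1, c1, b2, c2}" "a \<notin> {b1, c1, b2, c2}"
        using a_new[OF S(1) QV] by auto
      have "trilinear u b1 c1 (axis j 1) + trilinear u b2 c2 (axis j 1) = 0" for j
        using contract[of j]
        by (simp add: 1(2) 2(2) True distrib_left sum.distrib trilinear_wedge[OF u] flip: right_diff_distrib)
      then have sum0: "trilinear u b1 c1 y + trilinear u b2 c2 y = 0" for y
        by (subst (1 2) trilinear_axis) (simp flip: sum.distrib distrib_left)
      have rep: "trilinear u x x z = 0" "trilinear u x z x = 0" "trilinear u z x x = 0" for x z
        using alt(3)[of x z] perm[of x x z] by auto
      \<comment> \<open>Inserting one of the four vectors for \<open>y\<close> in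
        \<open>sum0\<close> repeats an argument in one summand, so the other summand is zero. These
        are all triples of distinct vectors among the four, up to order.\<close>
      have "trilinear u b1 c1 b2 = 0" "trilinear u b1 c1 c2 = 0" "trilinear u b2 c2 b1 = 0" "trilinear u b2 c2 c1 = 0"
        using sum0[of b1] sum0[of c1] sum0[of b2] sum0[of c2] by (simp_all add: rep)
      note zero = this[THEN perm] this
      have Q0: "trilinear u x y z = 0" if "x \<in> {b1, c1, b2, c2}" "y \<in> {b1, c1, b2, c2}" "z \<in> {b1, c1, b2, c2}" for x y z
        using that by (elim insertE emptyE) (simp_all add: zero rep)
      define Q where "Q = {b1, c1, b2, c2}"
      define W :: "'a ^ 9 \<Rightarrow> int" where "W x = (if x = a then -4 else if x \<in> Q then -1 else 2)" for x
      have Na: "N a x" "N x a" if "x \<in> insert a Q" for x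
        using that QV NV N_sym N_refl by (auto simp: Q_def)
      show False
      proof (rule destabilising_independent[OF fin closed indep(1), of W 2])
        show "W x + W y + W z \<ge> 0" if "trilinear u x y z \<noteq> 0" for x y z
        proof -
          have "x = a \<Longrightarrow> y \<notin> insert a Q \<and> z \<notin> insert a Q"
            "y = a \<Longrightarrow> x \<notin> insert a Q \<and> z \<notin> insert a Q"
            "z = a \<Longrightarrow> x \<notin> insert a Q \<and> y \<notin> insert a Q"
            using N[OF that] Na by blast+
          moreover have "\<not> (x \<in> Q \<and> y \<in> Q \<and> z \<in> Q)"
            using Q0 that unfolding Q_def by blast
          ultimately show ?thesis
            by (cases "x = a"; cases "y = a"; cases "z = a"; cases "x \<in> Q"; cases "y \<in> Q"; cases "z \<in> Q") (simp_all add: W_def)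
        qed
        show "(\<Sum>x\<in>{a, b1, c1, b2, c2}. W x) + (9 - int (card {a, b1, c1, b2, c2})) * 2 = 0"
          using S(2,3) S2(2) indep(2) by (auto simp: W_def Q_def)
        show "card {a, b1, c1, b2, c2} < 9"
          using S(2,3) S2(2) indep(2) by auto
      qed (auto simp: W_def Q_def)
    next
      case False
      then obtain p2 q2 where pq2: "\<omega>2 p2 q2 \<noteq> 0" by blast
      define V2 where "V2 = V1 \<inter> ({v. v $ p1 = 0} \<inter> {v. v $ q1 = 0})"
      have V2: "vec.subspace V2"
        unfolding V2_def by (intro vec.subspace_inter V1 subspace_coordinate_zero)
      have cols2: "(\<chi> i. \<omega>2 i j) \<in> V2" for j
        using 2(9)[of j] by (simp add: V2_def 2(10,11))
      obtain b3 c3 :: "'a ^ 9" where 3: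
        "b3 \<in> V2" "c3 \<in> V2" "b3 $ p2 = 0" "b3 $ q2 \<noteq> 0" "c3 $ p2 \<noteq> 0" "c3 $ q2 = 0"
        by (rule symplectic_step[OF 2(1) pq2 V2 cols2]) (rule that)
      have S3: "vec.independent {b3, c3}" "b3 \<noteq> c3"
        using pair[of "{}" p2 q2 b3 c3] 3 vec.independent_empty by auto
      then have S2: "vec.independent {b2, c2, b3, c3}" "c2 \<notin> {b3, c3}" "b2 \<notin> {c2, b3, c3}"
        using pair[of "{b3, c3}" p1 q1 b2 c2] 2(5-8) 3(1,2) by (auto simp: V2_def)
      then have S: "vec.independent {b1, c1, b2, c2, b3, c3}" "c1 \<notin> {b2, c2, b3, c3}" "b1 \<notin> {c1, b2, c2, b3, c3}"
        using pair[of "{b2, c2, b3, c3}" p0 q0 b1 c1] 1(5-8) 2(3,4) 3(1,2) by (auto simp: V1_def V2_def)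
      have QV: "{b1, c1, b2, c2, b3, c3} \<subseteq> V" using 1(3,4) 2(3,4) 3(1,2) by (auto simp: V1_def V2_def)
      have indep: "vec.independent {a, b1, c1, b2, c2, b3, c3}" "a \<notin> {b1, c1, b2, c2, b3, c3}"
        using a_new[OF S(1) QV] by auto
      define Q where "Q = {b1, c1, b2, c2, b3, c3}"
      define W :: "'a ^ 9 \<Rightarrow> int" where "W x = (if x = a then -2 else if x \<in> Q then 0 else 1)" for x
      have Na: "N a x" "N x a" if "x \<in> insert a Q" for x
        using that QV NV N_sym N_refl by (auto simp: Q_def)
      show False
      proof (rule destabilising_independent[OF fin closed indep(1), of W 1])
        show "W x + W y + W z \<ge> 0" if "trilinear u x y z \<noteq> 0" for x y z
        proof -
          have "x = a \<Longrightarrow> y \<notin> insert a Q \<and> z \<notin> insert a Q"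
            "y = a \<Longrightarrow> x \<notin> insert a Q \<and> z \<notin> insert a Q"
            "z = a \<Longrightarrow> x \<notin> insert a Q \<and> y \<notin> insert a Q"
            using N[OF that] Na by blast+
          then show ?thesis
            by (cases "x = a"; cases "y = a"; cases "z = a"; cases "x \<in> Q"; cases "y \<in> Q"; cases "z \<in> Q") (simp_all add: W_def)
        qed
        show "(\<Sum>x\<in>{a, b1, c1, b2, c2, b3, c3}. W x) + (9 - int (card {a, b1, c1, b2, c2, b3, c3})) * 1 = 0"
          using S(2,3) S2(2,3) S3(2) indep(2) by (auto simp: W_def Q_def)
        show "card {a, b1, c1, b2, c2, b3, c3} < 9"
          using S(2,3) S2(2,3) S3(2) indep(2) by auto
      qed (auto simp: W_def Q_def)
    qed
  qed
qed

section \<open>The cubic and its singular locus\<close>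

lemma compl_pfaffian_move_two:
  assumes A: "alternating A"
  shows "compl_pfaffian A (zs @ [q, p]) = compl_pfaffian A (q # p # zs)"
proof -
  note B = alternating_bordered[OF A]
  have "compl_pfaffian A (zs @ [q, p]) = (-1) ^ length zs * pfaffian (bordered A) (map Inl univ_list @ Inr q # map Inr zs @ [Inr p])"
    using pfaffian_move[OF B, of "map Inl univ_list" "map Inr zs" "Inr q" "[Inr p]"] by (simp add: compl_pfaffian_def)
  also have "pfaffian (bordered A) (map Inl univ_list @ Inr q # map Inr zs @ [Inr p]) = (-1) ^ length zs * compl_pfaffian A (q # p # zs)"
    using pfaffian_move[OF B, of "map Inl univ_list @ [Inr q]" "map Inr zs" "Inr p" "[]"] by (simp add: compl_pfaffian_def)
  finally show ?thesis by (simp flip: mult.assoc power_add)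
qed

lemma homogeneous_pfaffian:
  fixes A :: "'n \<Rightarrow> 'n \<Rightarrow> ('i::finite, 'a::comm_ring_1) mpoly"
  assumes "\<And>i j. homogeneous 1 (A i j)"
  shows "length xs = 2 * n \<Longrightarrow> homogeneous n (pfaffian A xs)"
proof (induction n arbitrary: xs)
  case 0
  then show ?case by (simp add: homogeneous_1)
next
  case (Suc n)
  then obtain x ys where xs: "xs = x # ys" and ys: "length ys = Suc (2 * n)" by (cases xs) auto
  show ?case
    unfolding xs pfaffian_Cons
  proof (rule homogeneous_sum)
    fix m assume "m \<in> {..<length ys}"
    then have "homogeneous n (pfaffian A (del m ys))" using ys by (intro Suc.IH) simp
    from homogeneous_mult[OF assms this] have "homogeneous (Suc n) (A x (ys ! m) * pfaffian A (del m ys))" by simp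
    moreover have "(-1) ^ m * A x (ys ! m) * pfaffian A (del m ys) =
        (if even m then A x (ys ! m) * pfaffian A (del m ys) else - (A x (ys ! m) * pfaffian A (del m ys)))"
      by simp
    ultimately show "homogeneous (Suc n) ((-1) ^ m * A x (ys ! m) * pfaffian A (del m ys))"
      by (cases "even m") (simp_all add: homogeneous_uminus)
  qed
qed

section \<open>Division by a variable\<close>

lemma lookup_Var_mult:
  "Poly_Mapping.lookup (Var i * p) m =
     (if Poly_Mapping.lookup m i = 0 then 0 else Poly_Mapping.lookup p (m - Poly_Mapping.single i 1))"
  for p :: "('i, 'a::comm_semiring_1) mpoly"
proof (induction p rule: poly_mapping_induct)
  case (single n c)
  let ?e = "Poly_Mapping.single i (1::nat)"
  have "?e + n = m \<longleftrightarrow> Poly_Mapping.lookup m i \<noteq> 0 \<and> n = m - ?e"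
  proof
    assume "?e + n = m"
    then show "Poly_Mapping.lookup m i \<noteq> 0 \<and> n = m - ?e" by (auto simp: lookup_add)
  next
    assume *: "Poly_Mapping.lookup m i \<noteq> 0 \<and> n = m - ?e"
    then show "?e + n = m"
      by (intro poly_mapping_eqI) (auto simp: lookup_add lookup_minus lookup_single when_def)
  qed
  then show ?case by (simp add: Var_def mult_single lookup_single when_def)
qed (simp add: distrib_left lookup_add)

lemma lookup_Var_mult_add: "Poly_Mapping.lookup (Var i * p) (m + Poly_Mapping.single i 1) = Poly_Mapping.lookup p m"
  for p :: "('i, 'a::comm_semiring_1) mpoly"
  by (simp add: lookup_Var_mult lookup_add)

lemma Var_mult_cancel: "Var i * p = Var i * q \<Longrightarrow> p = q" for p q :: "('i, 'a::comm_semiring_1) mpoly"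
  by (rule poly_mapping_eqI) (metis lookup_Var_mult_add)

text \<open>For \<open>i \<noteq> j\<close>, comparing coefficients in
  \<open>Var i * g j = Var j * g i\<close> shows that every monomial of \<open>g i\<close> contains
  the variable \<open>i\<close>. The quotient is \<open>F\<close>, and cancelling
  \<open>Var i\<close> transfers the factorization to every other index.\<close>

lemma common_factor:
  fixes g :: "'i::finite \<Rightarrow> ('i, 'a::comm_ring_1) mpoly"
  assumes g: "\<And>i j. Var i * g j = Var j * g i" and hom: "\<And>i. homogeneous (Suc d) (g i)" and ij: "i \<noteq> (j :: 'i)"
  obtains F where "homogeneous d F" "\<And>i. g i = Var i * F"
proof -
  let ?e = "\<lambda>i. Poly_Mapping.single i (1::nat)"
  have pos: "Poly_Mapping.lookup m i \<noteq> 0" if "m \<in> Poly_Mapping.keys (g i)" for m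
  proof
    assume 0: "Poly_Mapping.lookup m i = 0"
    have "Poly_Mapping.lookup (g i) m = Poly_Mapping.lookup (Var i * g j) (m + ?e j)"
      unfolding g[of i j] lookup_Var_mult_add ..
    also have "\<dots> = 0" using ij 0 by (simp add: lookup_Var_mult lookup_add lookup_single when_def)
    finally show False using that by (simp add: in_keys_iff)
  qed
  define F where "F = (\<Sum>m\<in>Poly_Mapping.keys (g i). Poly_Mapping.single (m - ?e i) (Poly_Mapping.lookup (g i) m))"
  have gi: "g i = Var i * F"
  proof -
    have "Var i * F = (\<Sum>m\<in>Poly_Mapping.keys (g i). Poly_Mapping.single m (Poly_Mapping.lookup (g i) m))"
      unfolding F_def sum_distrib_left
    proof (rule sum.cong[OF refl])
      fix m assume "m \<in> Poly_Mapping.keys (g i)"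
      then have "?e i + (m - ?e i) = m"
        using pos by (intro poly_mapping_eqI) (auto simp: lookup_add lookup_minus lookup_single when_def dest: pos)
      then show "Var i * Poly_Mapping.single (m - ?e i) (Poly_Mapping.lookup (g i) m) = Poly_Mapping.single m (Poly_Mapping.lookup (g i) m)"
        by (simp add: Var_def mult_single)
    qed
    also have "\<dots> = g i"
      by (intro poly_mapping_eqI) (auto simp: lookup_sum lookup_single when_def in_keys_iff)
    finally show ?thesis ..
  qed
  have "homogeneous d F"
    unfolding homogeneous_def
  proof
    fix m assume m: "m \<in> Poly_Mapping.keys F"
    have "m + ?e i \<in> Poly_Mapping.keys (g i)"
      using m unfolding in_keys_iff gi lookup_Var_mult_add .
    then have "(\<Sum>l\<in>UNIV. Poly_Mapping.lookup (m + ?e i) l) = Suc d"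
      using hom[of i] by (simp add: homogeneous_def)
    moreover have "(\<Sum>l\<in>UNIV. Poly_Mapping.lookup (?e i) l) = 1"
      using homogeneous_Var[of i] by (simp add: homogeneous_def Var_def)
    ultimately show "(\<Sum>l\<in>UNIV. Poly_Mapping.lookup m l) = d"
      by (simp add: lookup_add sum.distrib)
  qed
  moreover have "g l = Var l * F" for l
  proof (rule Var_mult_cancel)
    show "Var i * g l = Var i * (Var l * F)"
      unfolding g[of i l] gi by (simp add: mult.left_commute)
  qed
  ultimately show ?thesis using that by blast
qed

lemma Const_uminus: "Const (- c) = - Const (c :: 'a::comm_ring_1)"
  by (simp add: Const_def single_uminus)

lemma Const_0 [simp]: "Const 0 = 0"
  by (simp add: Const_def)

section \<open>The matrix of linear forms and its Pfaffians\<close>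

lemma alternating_Phi:
  assumes u: "trivector u"
  shows "alternating (Phi u)"
  unfolding alternating_def
proof (intro conjI allI)
  fix i j
  show "Phi u j i = - Phi u i j"
    unfolding Phi_def sum_negf[symmetric]
    by (intro sum.cong refl, subst trivectorD(1)[OF u]) (simp add: Const_uminus)
  show "Phi u i i = 0" by (simp add: Phi_def trivectorD(3)[OF u])
qed

lemma eval_Phi: "eval a (Phi u i j) = (\<Sum>l\<in>UNIV. u (i, j, l) * a l)"
  by (simp add: Phi_def eval_sum eval_mult)

lemma pdiff_Phi: "pdiff l (Phi u i j) = Const (u (i, j, l))"
proof -
  have "pdiff l (Phi u i j) = (\<Sum>m\<in>UNIV. if l = m then Const (u (i, j, m)) else 0)"
    unfolding Phi_def pdiff_sum by (intro sum.cong refl) (simp add: pdiff_mult pdiff_Var)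
  then show ?thesis by simp
qed

lemma homogeneous_Phi: "homogeneous 1 (Phi u i j)"
  unfolding Phi_def
proof (rule homogeneous_sum)
  fix l
  show "homogeneous 1 (Const (u (i, j, l)) * Var l)"
    using homogeneous_mult[OF homogeneous_Const homogeneous_Var] by simp
qed

lemma poly_ac_Phi: "poly_ac (Phi u i j) = Phi (\<lambda>t. to_ac (u t)) i j"
  by (simp add: Phi_def poly_ac_sum poly_ac_mult poly_ac_Const poly_ac_Var)

lemma poly_ac_pfaffian_Phi: "poly_ac (pfaffian (Phi u) xs) = pfaffian (Phi (\<lambda>t. to_ac (u t))) xs"
  using pfaffian_hom[of poly_ac "Phi u" xs] by (simp add: poly_ac_add poly_ac_mult poly_ac_Phi)

lemma Phi_kernel:
  assumes u: "trivector u"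
  shows "(\<Sum>r\<in>UNIV. Var r * Phi u r p) = 0"
proof -
  define f where "f r l = Var r * (Const (u (r, p, l)) * Var l)" for r l
  have "f r l + f l r = 0" for r l
    unfolding f_def by (subst trivectorD(5)[OF u]) (simp add: Const_uminus algebra_simps)
  moreover have "f r r = 0" for r
    unfolding f_def by (subst trivectorD(2)[OF u]) (simp add: trivectorD(3)[OF u])
  ultimately have "(\<Sum>r\<in>UNIV. \<Sum>l\<in>UNIV. f r l) = 0" unfolding sum_off_diagonal by simp
  then show ?thesis by (simp add: f_def Phi_def sum_distrib_left)
qed

text \<open>The entries of \<open>Phi u\<close> are linear, so their derivatives are the
  coefficients of \<open>u\<close>. With nine indices, an odd number of deletions leaves a Pfaffian
  of even size, as the derivation formula demands.\<close>

lemma pdiff_compl_pfaffian_Phi: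
  assumes u: "trivector u" and "odd (length zs)"
  shows "pdiff j (compl_pfaffian (Phi u) zs) = (\<Sum>p\<in>UNIV. \<Sum>q\<in>{p<..}. Const (u (p, q, j)) * compl_pfaffian (Phi u) (q # p # zs))"
  using compl_pfaffian_derivation[OF alternating_Phi[OF u], of "pdiff j" zs] assms(2)
  by (simp add: pdiff_add pdiff_mult pdiff_Phi compl_pfaffian_move_two[OF alternating_Phi[OF u]])

lemma compl_pfaffian_wedge_Phi:
  assumes u: "trivector u"
  shows "(\<Sum>m<length zs. (-1) ^ m * Var (zs ! m) * compl_pfaffian (Phi u) (del m zs)) = 0"
  by (rule compl_pfaffian_wedge[OF alternating_Phi[OF u] Phi_kernel[OF u]])

text \<open>
  If the claim failed, the functional \<open>\<theta>\<close> of Nakayama's lemma would be an alternating form that is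
  divisible by \<open>a\<close> and annihilated by contraction with the matrix at \<open>a\<close> and with its derivatives;
  fixing all but two arguments of \<open>\<theta>\<close> gives a form excluded by stability.
\<close>

lemma compl_pfaffian_mem_of_stable:
  fixes v :: "'a::alg_closed_field tensor3"
  assumes v: "trivector v" and fin: "finite (stabilizer v)" and closed: "zariski_closed (SL9_orbit v)"
    and a: "a \<noteq> (\<lambda>_. 0)"
    and L: "ideal.subspace L" and sat: "\<And>g p. eval a g \<noteq> 0 \<Longrightarrow> g * p \<in> L \<Longrightarrow> p \<in> L"
    and m: "odd m" and low: "\<And>zs. length zs = m \<Longrightarrow> compl_pfaffian (Phi v) zs \<in> L"
    and low': "\<And>zs j. length zs = m \<Longrightarrow> pdiff j (compl_pfaffian (Phi v) zs) \<in> L"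
    and xs: "length xs = m + 2"
  shows "compl_pfaffian (Phi v) xs \<in> L"
proof (rule ccontr)
  assume nin: "compl_pfaffian (Phi v) xs \<notin> L"
  let ?f = "compl_pfaffian (Phi v)"
  note A = alternating_Phi[OF v]
  define S :: "9 list set" where "S = {xs. length xs = m + 2}"
  have finS: "finite S" using finite_lists_length_eq[of "UNIV :: 9 set" "m + 2"] by (simp add: S_def)
  obtain \<theta> where \<theta>: "\<exists>s\<in>S. \<theta> s \<noteq> 0" "\<And>Q. (\<Sum>s\<in>S. Q s * ?f s) \<in> L \<Longrightarrow> (\<Sum>s\<in>S. eval a (Q s) * \<theta> s) = 0"
  proof (rule nakayama_functional[OF finS L sat])
    show "xs \<in> S" using xs by (simp add: S_def)
    show "?f xs \<notin> L" by (rule nin)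
  qed (use that in blast)+
  have "\<forall>Q. (\<Sum>s\<in>S. Q s * ?f s) \<in> L \<longrightarrow> (\<Sum>s\<in>S. eval a (Q s) * \<theta> s) = 0" using \<theta>(2) by blast
  note rel = sum_reindex_functional[OF finS this]
  have swap: "\<theta> (zs @ x # y # ys) = - \<theta> (zs @ y # x # ys)" if "length (zs @ x # y # ys) = m + 2" for zs x y ys
  proof -
    have "(\<Sum>t\<in>UNIV. 1 * ?f (if t then zs @ x # y # ys else zs @ y # x # ys)) = 0"
      by (simp add: UNIV_bool compl_pfaffian_swap[OF A, of zs x y ys])
    then have "(\<Sum>t\<in>UNIV. eval a 1 * \<theta> (if t then zs @ x # y # ys else zs @ y # x # ys)) = 0"
      using that ideal.subspace_0[OF L] by (intro rel[where T = UNIV and Q = "\<lambda>_. 1"]) (auto simp: S_def)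
    then show ?thesis by (simp add: UNIV_bool eq_neg_iff_add_eq_0 add.commute)
  qed
  have repeat: "\<theta> zs = 0" if "\<not> distinct zs" "length zs = m + 2" for zs
  proof -
    have "(\<Sum>t\<in>{()}. eval a 1 * \<theta> zs) = 0"
      using that ideal.subspace_0[OF L] by (intro rel[where T = "{()}" and h = "\<lambda>_. zs" and Q = "\<lambda>_. 1"]) (auto simp: S_def compl_pfaffian_not_distinct[OF A])
    then show ?thesis by simp
  qed
  \<comment> \<open>The contraction equals a combination of Pfaffians with only \<open>m\<close>
    deletions, which \<open>low\<close> puts into \<open>L\<close>.\<close>
  have ker: "(\<Sum>p\<in>UNIV. eval a (Phi v r p) * \<theta> (p # zs)) = 0" if "length zs = m + 1" for r zs
  proof (rule rel)
    have "(\<Sum>i<length zs. (-1) ^ i * of_bool (r = zs ! i) * ?f (del i zs)) \<in> L"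
      using that by (intro ideal.subspace_sum[OF L] ideal.subspace_scale[OF L] low) simp
    then show "(\<Sum>p\<in>UNIV. Phi v r p * ?f (p # zs)) \<in> L"
      unfolding compl_pfaffian_contract[OF A] .
  qed (use that in \<open>auto simp: S_def\<close>)
  have wedge: "(\<Sum>i<m + 3. eval a ((-1) ^ i * Var (zs ! i)) * \<theta> (del i zs)) = 0" if "length zs = m + 3" for zs
  proof (rule rel)
    show "(\<Sum>i<m + 3. ((-1) ^ i * Var (zs ! i)) * ?f (del i zs)) \<in> L"
      using compl_pfaffian_wedge_Phi[OF v, of zs] ideal.subspace_0[OF L] by (simp add: that)
  qed (use that in \<open>auto simp: S_def\<close>)
  have deriv: "(\<Sum>p\<in>UNIV. \<Sum>q\<in>{p<..}. v (p, q, j) * \<theta> (q # p # zs)) = 0" if "length zs = m" for j zs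
  proof -
    have "(\<Sum>(p, q)\<in>(SIGMA p:UNIV. {p<..}). Const (v (p, q, j)) * ?f (q # p # zs)) = pdiff j (?f zs)"
      using m that by (simp add: pdiff_compl_pfaffian_Phi[OF v] sum.Sigma)
    then have "(\<Sum>t\<in>(SIGMA p:UNIV. {p<..}). Const (v (fst t, snd t, j)) * ?f (snd t # fst t # zs)) \<in> L"
      using low'[OF that, of j] by (simp add: case_prod_beta)
    then have "(\<Sum>t\<in>(SIGMA p:UNIV. {p<..}). eval a (Const (v (fst t, snd t, j))) * \<theta> (snd t # fst t # zs)) = 0"
      using that by (intro rel) (auto simp: S_def)
    then show ?thesis by (simp add: sum.Sigma case_prod_beta)
  qed
  obtain k where k: "a k \<noteq> 0" using a by auto
  obtain s where s: "length s = m + 2" "\<theta> s \<noteq> 0" using \<theta>(1) by (auto simp: S_def)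
  \<comment> \<open>The wedge relation for \<open>k # s\<close> expresses
    \<open>a k * \<theta> s\<close> by values of \<open>\<theta>\<close> on lists starting with
    \<open>k\<close>, so one of these is nonzero. This is where \<open>\<theta>\<close> is divided
    by \<open>a\<close>.\<close>
  obtain i where i: "i < m + 2" "\<theta> (k # del i s) \<noteq> 0"
  proof -
    have "\<exists>i<m + 2. \<theta> (k # del i s) \<noteq> 0"
    proof (rule ccontr)
      assume "\<not> ?thesis"
      then have *: "\<theta> (k # del i s) = 0" if "i < m + 2" for i using that by blast
      have "(\<Sum>i<Suc (m + 2). eval a ((-1) ^ i * Var ((k # s) ! i)) * \<theta> (del i (k # s))) = 0"
        using wedge[of "k # s"] s(1) by (simp add: numeral_3_eq_3)
      moreover have "del (Suc i) (k # s) = k # del i s" for i by (simp add: del_def)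
      moreover have "del 0 (k # s) = s" by (simp add: del_def)
      ultimately have "a k * \<theta> s = 0"
        unfolding sum.lessThan_Suc_shift using * by simp
      then show False using k s(2) by simp
    qed
    then show ?thesis using that by blast
  qed
  have "length (del i s) = m + 1" using i(1) s(1) by simp
  moreover have "m \<noteq> 0" using m by (intro notI) simp
  ultimately obtain p0 q0 zs where ys: "del i s = p0 # q0 # zs" and zs: "length zs = m - 1" "m > 0"
    by (cases "del i s"; cases "tl (del i s)") auto
  \<comment> \<open>The form has \<open>m + 2\<close> arguments: one is \<open>k\<close>, and the
    \<open>m - 1\<close> entries of \<open>zs\<close> are frozen at values where it is
    nonzero.\<close>
  define \<omega> where "\<omega> p q = \<theta> (k # p # q # zs)" for p q
  show False
  proof (rule not_stable_of_form[OF v fin closed, of "\<chi> i. a i" k \<omega> p0 q0])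
    show "(\<chi> i. a i) $ k \<noteq> 0" using k by simp
    show "\<omega> p0 q0 \<noteq> 0" using i(2) by (simp add: \<omega>_def ys)
    show "\<omega> k q = 0" for q unfolding \<omega>_def using zs by (intro repeat) auto
    show "alternating \<omega>"
      unfolding alternating_def
    proof (intro conjI allI)
      show "\<omega> q p = - \<omega> p q" for p q
        unfolding \<omega>_def using swap[of "[k]" q p zs] zs by simp
      show "\<omega> p p = 0" for p unfolding \<omega>_def using zs by (intro repeat) auto
    qed
    show "(\<Sum>p\<in>UNIV. (\<Sum>l\<in>UNIV. v (r, p, l) * (\<chi> i. a i) $ l) * \<omega> p q) = 0" for r q
    proof -
      have "\<omega> p q = - \<theta> (p # k # q # zs)" for p
        unfolding \<omega>_def using swap[of "[]" k p "q # zs"] zs by simp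
      then show ?thesis using ker[of "k # q # zs" r] zs by (simp add: eval_Phi sum_negf)
    qed
    show "(\<Sum>p\<in>UNIV. \<Sum>q\<in>{p<..}. v (p, q, j) * \<omega> p q) = 0" for j
    proof -
      have "\<omega> p q = - \<theta> (q # p # k # zs)" for p q
        unfolding \<omega>_def using swap[of "[]" k p "q # zs"] swap[of "[p]" k q zs] swap[of "[]" p q "k # zs"] zs by simp
      then show ?thesis using deriv[of "k # zs" j] zs by (simp add: sum_negf)
    qed
  qed
qed

lemma pfaffians_compl_pfaffian:
  fixes A :: "'i::finite \<Rightarrow> 'i \<Rightarrow> 'a::comm_ring_1"
  assumes A: "alternating A" and q: "q \<in> pfaffians n A" and n: "n + m = CARD('i)"
  obtains zs where "length zs = m" "q = compl_pfaffian A zs \<or> q = - compl_pfaffian A zs"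
proof -
  obtain xs where xs: "q = pfaffian A xs" "distinct xs" "length xs = n"
    using q by (auto simp: pfaffians_def)
  obtain zs where zs: "set zs = UNIV - set xs" "distinct zs"
    using finite_distinct_list[of "UNIV - set xs"] by auto
  have "length zs = CARD('i) - n"
    using distinct_card[OF zs(2)] distinct_card[OF xs(2)] xs(3) zs(1) by (simp add: card_Diff_subset)
  then show ?thesis using that[of zs] pfaffian_eq_compl_pfaffian[OF A xs(2) zs(2,1)] xs(1) n by auto
qed

lemma compl_pfaffian_mem_ideal_pfaffians:
  fixes A :: "'i::finite \<Rightarrow> 'i \<Rightarrow> 'a::comm_ring_1"
  assumes A: "alternating A" and n: "n + length zs = CARD('i)"
  shows "compl_pfaffian A zs \<in> ideal_of (pfaffians n A)"
proof (cases "distinct zs")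
  case False
  then show ?thesis by (simp add: compl_pfaffian_not_distinct[OF A] ideal.subspace_0 subspace_ideal_of)
next
  case True
  obtain xs where xs: "set xs = UNIV - set zs" "distinct xs"
    using finite_distinct_list[of "UNIV - set zs"] by auto
  have "length xs = n"
    using distinct_card[OF xs(2)] distinct_card[OF True] xs(1) n by (simp add: card_Diff_subset)
  then have "pfaffian A xs \<in> ideal_of (pfaffians n A)"
    using xs(2) by (intro mem_ideal_of) (auto simp: pfaffians_def)
  moreover have "set zs = UNIV - set xs" using xs(1) by auto
  then have "pfaffian A xs = compl_pfaffian A zs \<or> pfaffian A xs = - compl_pfaffian A zs"
    by (rule pfaffian_eq_compl_pfaffian[OF A xs(2) True])
  ultimately show ?thesis
    using ideal.subspace_neg[OF subspace_ideal_of, of "pfaffian A xs"] by (metis minus_minus)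
qed

lemma poly_ac_rank_locus_eqs: "poly_ac ` rank_locus_eqs r u = rank_locus_eqs r (\<lambda>t. to_ac (u t))"
  by (simp add: rank_locus_eqs_def pfaffians_def setcompr_eq_image image_image poly_ac_pfaffian_Phi)

lemma poly_ac_singular_locus_eqs: "poly_ac ` singular_locus_eqs F = singular_locus_eqs (poly_ac F)"
  by (simp add: singular_locus_eqs_def image_image poly_ac_pdiff)

theorem lemma3p3:
  fixes u :: "'k::field tensor3"
  assumes "trivector u" and "stable_trivector u"
  shows "\<exists>F :: (9, 'k) mpoly. F \<noteq> 0 \<and> homogeneous 3 F \<and>
    same_subscheme (rank_locus_eqs 3 u) {F} \<and>
    same_subscheme (singular_locus_eqs F) (rank_locus_eqs 2 u)"
proof -
  define v where "v = (\<lambda>t. to_ac (u t))"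
  note u = assms(1)
  have fin: "finite (stabilizer v)" and closed: "zariski_closed (SL9_orbit v)"
    using assms(2) by (auto simp: stable_trivector_def v_def Let_def)
  have v: "trivector v"
    unfolding trivector_def v_def
  proof (intro conjI allI)
    fix i j l
    show "to_ac (u (j, i, l)) = - to_ac (u (i, j, l))" by (subst trivectorD(1)[OF u]) simp
    show "to_ac (u (i, l, j)) = - to_ac (u (i, j, l))" by (subst trivectorD(2)[OF u]) simp
    show "to_ac (u (i, i, l)) = 0" "to_ac (u (i, l, l)) = 0" by (simp_all add: trivectorD(3,4)[OF u])
  qed
  note Au = alternating_Phi[OF u] and Av = alternating_Phi[OF v]
  have "Var i * compl_pfaffian (Phi u) [j] = Var j * compl_pfaffian (Phi u) [i]" for i j
    using compl_pfaffian_wedge_Phi[OF u, of "[i, j]"] by (simp add: numeral_2_eq_2 del_def)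
  moreover have "homogeneous (Suc 3) (compl_pfaffian (Phi u) [i])" for i
  proof -
    obtain xs :: "9 list" where xs: "set xs = UNIV - {i}" "distinct xs"
      using finite_distinct_list[of "UNIV - {i}"] by auto
    have "length xs = 8" using distinct_card[OF xs(2)] xs(1) by simp
    then have "homogeneous 4 (pfaffian (Phi u) xs)"
      by (intro homogeneous_pfaffian homogeneous_Phi) simp
    moreover have "set [i] = UNIV - set xs" using xs(1) by auto
    then have "pfaffian (Phi u) xs = compl_pfaffian (Phi u) [i] \<or> pfaffian (Phi u) xs = - compl_pfaffian (Phi u) [i]"
      by (intro pfaffian_eq_compl_pfaffian[OF Au xs(2)]) auto
    ultimately show ?thesis
      using homogeneous_uminus[of 4 "pfaffian (Phi u) xs"] by auto
  qed
  moreover have "(0 :: 9) \<noteq> 1" by simp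
  ultimately obtain F where F: "homogeneous 3 F" "\<And>i. compl_pfaffian (Phi u) [i] = Var i * F"
    using common_factor[of "\<lambda>i. compl_pfaffian (Phi u) [i]" 3 0 1] by blast
  \<comment> \<open>\<open>F\<close> had to be found over \<open>k\<close> itself; stability and the
    points live over the algebraic closure, where \<open>G\<close> takes its place.\<close>
  define G where "G = poly_ac F"
  have poly_ac_compl_pfaffian: "poly_ac (compl_pfaffian (Phi u) zs) = compl_pfaffian (Phi v) zs" for zs
  proof -
    have "poly_ac (bordered (Phi u) p q) = bordered (Phi v) p q" for p q
      by (cases p; cases q) (auto simp: poly_ac_Phi v_def poly_ac_uminus)
    then show ?thesis
      unfolding compl_pfaffian_def
      using pfaffian_hom[of poly_ac "bordered (Phi u)"] by (simp add: poly_ac_add poly_ac_mult)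
  qed
  have G: "compl_pfaffian (Phi v) [i] = Var i * G" for i
    using poly_ac_compl_pfaffian[of "[i]"] by (simp add: F(2) poly_ac_mult poly_ac_Var G_def)
  have homG: "homogeneous 3 G" unfolding G_def by (rule homogeneous_poly_ac[OF F(1)])
  define J where "J = ideal_of (singular_locus_eqs G)"
  have GJ: "G \<in> J" "pdiff j G \<in> J" for j
    unfolding J_def by (auto intro!: mem_ideal_of simp: singular_locus_eqs_def)
  note J = subspace_ideal_of[of "singular_locus_eqs G", folded J_def]
  have "F \<noteq> 0"
  proof
    assume "F = 0"
    \<comment> \<open>The zero ideal is saturated at every point, so any nonzero point will
      do.\<close>
    define a :: "9 \<Rightarrow> 'k alg_closure" where "a = (\<lambda>_. 1)"
    have L: "ideal.subspace {0 :: (9, 'k alg_closure) mpoly}"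
      by (simp add: ideal.subspace_def)
    have sat: "p \<in> {0}" if "eval a g \<noteq> 0" "g * p \<in> {0}" for g p
      using that by auto
    \<comment> \<open>The Pfaffians have sizes 8, 6, 4, 2, 0 for \<open>n\<close> from 0 to 4. At
      \<open>n = 4\<close> all nine indices can be deleted, leaving the empty Pfaffian, which is
      1.\<close>
    have "compl_pfaffian (Phi v) zs \<in> {0}" if "length zs = 2 * n + 1" for n zs
      using that
    proof (induction n arbitrary: zs)
      case 0
      then obtain i where "zs = [i]" by (cases zs) auto
      then show ?case using \<open>F = 0\<close> by (simp add: G G_def)
    next
      case (Suc n)
      show ?case
      proof (rule compl_pfaffian_mem_of_stable[OF v fin closed _ L sat, where m = "2 * n + 1"])
        show "pdiff j (compl_pfaffian (Phi v) zs) \<in> {0}" if "length zs = 2 * n + 1" for zs j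
          using Suc.IH[OF that] by simp
      qed (use Suc in \<open>auto simp: a_def fun_eq_iff\<close>)
    qed
    from this[of univ_list 4] have "compl_pfaffian (Phi v) univ_list = 0"
      by (simp add: length_univ_list)
    then show False
      using pfaffian_eq_compl_pfaffian[OF Av, of "[]" univ_list] by (simp add: univ_list)
  qed
  moreover have "same_subscheme (rank_locus_eqs 3 u) {F}"
    unfolding same_subscheme_def poly_ac_rank_locus_eqs v_def[symmetric]
  proof (intro allI impI subset_antisym)
    fix a :: "9 \<Rightarrow> 'k alg_closure" assume "a \<noteq> (\<lambda>_. 0)"
    then obtain k where k: "a k \<noteq> 0" by auto
    show "ideal_stalk (ideal_of (rank_locus_eqs 3 v)) a \<subseteq> ideal_stalk (ideal_of (poly_ac ` {F})) a"
    proof (rule ideal_stalk_subset)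
      fix q assume "q \<in> rank_locus_eqs 3 v"
      then obtain zs where zs: "length zs = 1" "q = compl_pfaffian (Phi v) zs \<or> q = - compl_pfaffian (Phi v) zs"
        using pfaffians_compl_pfaffian[OF Av, of q 8 1] by (auto simp: rank_locus_eqs_def)
      then obtain i where "zs = [i]" by (cases zs) auto
      moreover have "Var i * G \<in> ideal_of {G}"
        by (intro ideal.subspace_scale[OF subspace_ideal_of] mem_ideal_of) simp
      ultimately have "1 * q \<in> ideal_of (poly_ac ` {F})"
        using zs(2) ideal.subspace_neg[OF subspace_ideal_of] by (auto simp: G simp flip: G_def)
      then show "\<exists>g e. homogeneous e g \<and> eval a g \<noteq> 0 \<and> g * q \<in> ideal_of (poly_ac ` {F})"
        using homogeneous_1 by (intro exI[of _ 1] exI[of _ 0]) auto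
    qed
    show "ideal_stalk (ideal_of (poly_ac ` {F})) a \<subseteq> ideal_stalk (ideal_of (rank_locus_eqs 3 v)) a"
    proof (rule ideal_stalk_subset)
      fix q assume "q \<in> poly_ac ` {F}"
      then have q: "q = G" by (simp add: G_def)
      \<comment> \<open>The Pfaffians provide only multiples of \<open>G\<close> by variables. As
        \<open>a k\<close> is nonzero, \<open>Var k\<close> serves as denominator.\<close>
      have "Var k * G \<in> ideal_of (rank_locus_eqs 3 v)"
        using compl_pfaffian_mem_ideal_pfaffians[OF Av, of 8 "[k]"] by (simp add: rank_locus_eqs_def G)
      then show "\<exists>g e. homogeneous e g \<and> eval a g \<noteq> 0 \<and> g * q \<in> ideal_of (rank_locus_eqs 3 v)"
        unfolding q using k homogeneous_Var by (intro exI[of _ "Var k"] exI[of _ 1]) auto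
    qed
  qed
  moreover have "same_subscheme (singular_locus_eqs F) (rank_locus_eqs 2 u)"
    unfolding same_subscheme_def poly_ac_rank_locus_eqs poly_ac_singular_locus_eqs v_def[symmetric] G_def[symmetric]
  proof (intro allI impI subset_antisym)
    fix a :: "9 \<Rightarrow> 'k alg_closure" assume a: "a \<noteq> (\<lambda>_. 0)"
    then obtain k where k: "a k \<noteq> 0" by auto
    let ?I = "ideal_of (rank_locus_eqs 2 v)"
    note I = subspace_ideal_of[of "rank_locus_eqs 2 v"]
    have three: "compl_pfaffian (Phi v) zs \<in> ?I" if "length zs = 3" for zs
      using compl_pfaffian_mem_ideal_pfaffians[OF Av, of 6 zs] that by (simp add: rank_locus_eqs_def)
    show "ideal_stalk (ideal_of (singular_locus_eqs G)) a \<subseteq> ideal_stalk ?I a"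
    proof (rule ideal_stalk_subset)
      fix q assume q: "q \<in> singular_locus_eqs G"
      \<comment> \<open>Contracting the Pfaffians with deletions \<open>p\<close>, \<open>r\<close>,
        \<open>k\<close> by row \<open>r\<close>, where \<open>r\<close> differs from
        \<open>k\<close>, leaves the single term with deletion \<open>k\<close>. So the 8 x 8
        Pfaffians lie in the ideal of the 6 x 6 ones.\<close>
      have kG: "Var k * G \<in> ?I"
      proof -
        obtain r where r: "r \<noteq> k" by (metis zero_neq_one)
        have "compl_pfaffian (Phi v) [k] = (\<Sum>p\<in>UNIV. Phi v r p * compl_pfaffian (Phi v) (p # [r, k]))"
          unfolding compl_pfaffian_contract[OF Av] using r by (simp add: numeral_2_eq_2 del_def)
        also have "\<dots> \<in> ?I"
          by (intro ideal.subspace_sum[OF I] ideal.subspace_scale[OF I] three) simp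
        finally show ?thesis by (simp add: G)
      qed
      show "\<exists>g e. homogeneous e g \<and> eval a g \<noteq> 0 \<and> g * q \<in> ?I"
      proof (cases "q = G")
        case True
        then show ?thesis using k kG homogeneous_Var by (intro exI[of _ "Var k"] exI[of _ 1]) auto
      next
        case False
        then obtain j where j: "q = pdiff j G" using q by (auto simp: singular_locus_eqs_def)
        have "pdiff j (compl_pfaffian (Phi v) [k]) \<in> ?I"
          unfolding pdiff_compl_pfaffian_Phi[OF v, of "[k]", simplified]
          by (intro ideal.subspace_sum[OF I] ideal.subspace_scale[OF I] three) simp
        \<comment> \<open>By the product rule this difference is the square of \<open>Var k\<close>
          times the partial derivative. The extra factor \<open>Var k\<close> makes the correction
          term a multiple of \<open>Var k * G\<close>, which covers the case
          \<open>j = k\<close>.\<close>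
        then have "Var k * pdiff j (Var k * G) - pdiff j (Var k) * (Var k * G) \<in> ?I"
          by (intro ideal.subspace_diff[OF I] ideal.subspace_scale[OF I] kG) (simp add: G)
        then have "(Var k * Var k) * pdiff j G \<in> ?I"
          by (simp add: pdiff_mult algebra_simps)
        moreover have "homogeneous (1 + 1) (Var k * Var k :: (9, 'k alg_closure) mpoly)"
          by (intro homogeneous_mult homogeneous_Var)
        ultimately show ?thesis
          unfolding j using k by (intro exI[of _ "Var k * Var k"] exI[of _ "1 + 1"]) (simp add: eval_mult)
      qed
    qed
    define L where "L = saturation a J"
    have JL: "p \<in> L" if "p \<in> J" for p using that saturation_superset unfolding L_def by blast
    have L: "ideal.subspace L" unfolding L_def by (rule subspace_saturation[OF J])
    have sat: "p \<in> L" if "eval a g \<noteq> 0" "g * p \<in> L" for g p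
      using that unfolding L_def by (rule saturation_saturated)
    have inL: "compl_pfaffian (Phi v) xs \<in> L" if "length xs = 3" for xs
    proof (rule compl_pfaffian_mem_of_stable[OF v fin closed a L sat, where m = 1])
      fix zs :: "9 list" and j assume "length zs = 1"
      then obtain i where zs: "zs = [i]" by (cases zs) auto
      show "compl_pfaffian (Phi v) zs \<in> L"
        unfolding zs G by (intro JL ideal.subspace_scale[OF J] GJ)
      show "pdiff j (compl_pfaffian (Phi v) zs) \<in> L"
        unfolding zs G pdiff_mult by (intro JL ideal.subspace_add[OF J] ideal.subspace_scale[OF J] GJ)
    qed (use that in auto)
    show "ideal_stalk ?I a \<subseteq> ideal_stalk (ideal_of (singular_locus_eqs G)) a"
    proof (rule ideal_stalk_subset)
      fix q assume q: "q \<in> rank_locus_eqs 2 v"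
      then obtain zs where zs: "length zs = 3" "q = compl_pfaffian (Phi v) zs \<or> q = - compl_pfaffian (Phi v) zs"
        using pfaffians_compl_pfaffian[OF Av, of q 6 3] by (auto simp: rank_locus_eqs_def)
      then have "q \<in> L" using inL[OF zs(1)] ideal.subspace_neg[OF L] by auto
      then obtain g where g: "eval a g \<noteq> 0" "g * q \<in> ideal_of (singular_locus_eqs G)"
        by (auto simp: L_def J_def saturation_def)
      \<comment> \<open>The saturation allowed arbitrary denominators. Since \<open>q\<close> and
        the generators of the Jacobian ideal are homogeneous, a component of the denominator serves
        as well.\<close>
      have "homogeneous 3 q"
        using q by (auto simp: rank_locus_eqs_def pfaffians_def intro!: homogeneous_pfaffian homogeneous_Phi)
      moreover have "\<exists>e. homogeneous e p" if "p \<in> singular_locus_eqs G" for p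
        using that homG homogeneous_pdiff[of 2 G] by (auto simp: singular_locus_eqs_def numeral_3_eq_3 numeral_2_eq_2)
      ultimately show "\<exists>g e. homogeneous e g \<and> eval a g \<noteq> 0 \<and> g * q \<in> ideal_of (singular_locus_eqs G)"
        using g by (intro homogeneous_denominator[where g = g]) auto
    qed
  qed
  ultimately show ?thesis using F(1) by blast
qed

end
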